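(* Let $\mathcal L$ be the linear category of a non-trivial model of linear logic and consider the default interpretation $[\![\cdot]\!]$ into $\mathrm{Inv}(\mathcal L)$. If a DR-net $\pi$ of conclusion $A$ belongs to $\mathbf{L^3}$, then $[\![\pi]\!]$ is a morphism of $\mathrm{Inv}(\mathcal L)$ from $(1,(id_1)_{k\in\mathbb Z})$ to $[\![A^+]\!]$.
   Context: A model of linear logic: a $\ast$-autonomous category $(\mathcal L,\otimes,1,\bot)$ with products, a Cartesian category $\mathcal M$ and a symmetric monoidal adjunction $L\dashv M$ between them ($!=LM$); it interprets formulas as objects and proofs of $A$ as morphisms $1\to[\![A]\!]$, invariantly under cut-elimination; non-trivial means two proofs of some formula get different interpretations; then there is an object $\Xi$ with $\gamma_{\Xi,\Xi}\neq id_{\Xi\otimes\Xi}$ ($\gamma$ the symmetry). $\mathrm{Inv}(\mathcal L)$: objects $(A,s)$ with $s=(s_k)_{k\in\mathbb Z}$ involutive automorphisms of $A$; morphisms $(A,s)\to(B,t)$ are $f:A\to B$ with $t_k f s_k=f$ for all $k$; it is again a model of linear logic with structure induced componentwise (e.g. $(A,s)\otimes(B,t)=(A\otimes B,(s_k\otimes t_k)_k)$, $!(A,s)=(!A,(!s_k)_k)$), and a model of stratified linear logic with the paragraph functor $\S(A,s)=(A,(s_{k-1})_{k\in\mathbb Z})$, identity on morphisms. The default assignment sends each propositional atom to $(\Xi\otimes\Xi,\xi)$ with $\xi_0=\gamma_{\Xi,\Xi}$ and $\xi_k=id_{\Xi\otimes\Xi}$ for $k\neq0$; $[\![\cdot]\!]$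 is the resulting interpretation of formulas (with $\S$ interpreted by the paragraph functor) and proofs. Since $\S$ is the identity on morphisms, every DR-net $\pi$ of conclusion $A$ (a linear logic proof net possibly containing paragraph links) has an interpretation $[\![\pi]\!]$, an arrow of $\mathcal L$ from $1$ to the underlying object of $[\![A]\!]$. $A^+$ is obtained from $A$ by replacing every $!$ by $!\S$ and every $?$ by $?\S$; $[\![A^+]\!]$ has the same underlying object as $[\![A]\!]$. Nets, DR-nets: finite graphs of links (axiom, cut, one, bottom, tensor, par, flat $A\to\flat A$, pax $\flat A\to\flat A$, why not $\flat A,\ldots,\flat A\to ?A$, of course $A\to !A$, paragraph $A\to\S A$) with boxes (an of course link and pax links bordering a subnet); a DR-net is a net all of whose switchings (keep one premise of each par/why not link, collapse outermost boxes) are acyclic, recursively in boxes, and with no $\flat$-formula conclusion. An exponential indexing of a net is $I$: edges $\to\mathbb Z$ with equal indices on axiom conclusions, on cut premises, on premises and conclusion of tensor, par, flat, pax links, premises of paragraph, of course and why not links indexed one more than the conclusion, and all conclusions of the net equally indexed. $\mathbf{L^3}$ is the set of DR-nets admitting an exponential indexing. *)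

theory Defs
  imports Main
begin

section \<open>Formulas\<close>

datatype form =
    Var nat | NVar nat
  | One | Bottom
  | Tensor form form | Parr form form
  | OfCourse form | WhyNot form
  | Para form

primrec neg :: "form \<Rightarrow> form" where
  "neg (Var x) = NVar x"
| "neg (NVar x) = Var x"
| "neg One = Bottom"
| "neg Bottom = One"
| "neg (Tensor A B) = Parr (neg A) (neg B)"
| "neg (Parr A B) = Tensor (neg A) (neg B)"
| "neg (OfCourse A) = WhyNot (neg A)"
| "neg (WhyNot A) = OfCourse (neg A)"
| "neg (Para A) = Para (neg A)"

primrec plus_form :: "form \<Rightarrow> form" where
  "plus_form (Var x) = Var x"
| "plus_form (NVar x) = NVar x"
| "plus_form One = One"
| "plus_form Bottom = Bottom"
| "plus_form (Tensor A B) = Tensor (plus_form A) (plus_form B)"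
| "plus_form (Parr A B) = Parr (plus_form A) (plus_form B)"
| "plus_form (OfCourse A) = OfCourse (Para (plus_form A))"
| "plus_form (WhyNot A) = WhyNot (Para (plus_form A))"
| "plus_form (Para A) = Para (plus_form A)"

primrec para_free :: "form \<Rightarrow> bool" where
  "para_free (Var x) \<longleftrightarrow> True"
| "para_free (NVar x) \<longleftrightarrow> True"
| "para_free One \<longleftrightarrow> True"
| "para_free Bottom \<longleftrightarrow> True"
| "para_free (Tensor A B) \<longleftrightarrow> para_free A \<and> para_free B"
| "para_free (Parr A B) \<longleftrightarrow> para_free A \<and> para_free B"
| "para_free (OfCourse A) \<longleftrightarrow> para_free A"
| "para_free (WhyNot A) \<longleftrightarrow> para_free A"
| "para_free (Para A) \<longleftrightarrow> False"

lemma neg_neg [simp]: "neg (neg A) = A"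
  by (induction A) auto

lemma neg_plus_form: "neg (plus_form A) = plus_form (neg A)"
  by (induction A) auto


section \<open>Nets\<close>

text \<open>Edges are labelled by a formula or by a flat formula \<open>Flat A\<close>; flat formulas are not
  formulas, so they cannot occur below a connective.\<close>

datatype label = Plain form | Flat form

text \<open>A link is identified with its kind and the edges it is incident to: premises first,
  conclusion last. The premises of a why not link are unordered and may be absent.\<close>

datatype 'e link =
    LAx 'e 'e
  | LCut 'e 'e
  | LOne 'e
  | LBot 'e
  | LTensor 'e 'e 'e
  | LPar 'e 'e 'e
  | LFlat 'e 'e
  | LPax 'e 'e
  | LWhyNot "'e set" 'e
  | LOfCourse 'e 'e
  | LPara 'e 'e

primrec prems :: "'e link \<Rightarrow> 'e set" where
  "prems (LAx a b) = {}"
| "prems (LCut a b) = {a, b}"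
| "prems (LOne c) = {}"
| "prems (LBot c) = {}"
| "prems (LTensor a b c) = {a, b}"
| "prems (LPar a b c) = {a, b}"
| "prems (LFlat a c) = {a}"
| "prems (LPax a c) = {a}"
| "prems (LWhyNot S c) = S"
| "prems (LOfCourse a c) = {a}"
| "prems (LPara a c) = {a}"

primrec concls :: "'e link \<Rightarrow> 'e set" where
  "concls (LAx a b) = {a, b}"
| "concls (LCut a b) = {}"
| "concls (LOne c) = {c}"
| "concls (LBot c) = {c}"
| "concls (LTensor a b c) = {c}"
| "concls (LPar a b c) = {c}"
| "concls (LFlat a c) = {c}"
| "concls (LPax a c) = {c}"
| "concls (LWhyNot S c) = {c}"
| "concls (LOfCourse a c) = {c}"
| "concls (LPara a c) = {c}"

primrec link_ok :: "('e \<Rightarrow> label) \<Rightarrow> 'e link \<Rightarrow> bool" where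
  "link_ok lb (LAx a b) \<longleftrightarrow> a \<noteq> b \<and> (\<exists>A. lb a = Plain A \<and> lb b = Plain (neg A))"
| "link_ok lb (LCut a b) \<longleftrightarrow> a \<noteq> b \<and> (\<exists>A. lb a = Plain A \<and> lb b = Plain (neg A))"
| "link_ok lb (LOne c) \<longleftrightarrow> lb c = Plain One"
| "link_ok lb (LBot c) \<longleftrightarrow> lb c = Plain Bottom"
| "link_ok lb (LTensor a b c) \<longleftrightarrow>
     a \<noteq> b \<and> (\<exists>A B. lb a = Plain A \<and> lb b = Plain B \<and> lb c = Plain (Tensor A B))"
| "link_ok lb (LPar a b c) \<longleftrightarrow>
     a \<noteq> b \<and> (\<exists>A B. lb a = Plain A \<and> lb b = Plain B \<and> lb c = Plain (Parr A B))"
| "link_ok lb (LFlat a c) \<longleftrightarrow> (\<exists>A. lb a = Plain A \<and> lb c = Flat A)"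
| "link_ok lb (LPax a c) \<longleftrightarrow> (\<exists>A. lb a = Flat A \<and> lb c = Flat A)"
| "link_ok lb (LWhyNot S c) \<longleftrightarrow> (\<exists>A. (\<forall>a\<in>S. lb a = Flat A) \<and> lb c = Plain (WhyNot A))"
| "link_ok lb (LOfCourse a c) \<longleftrightarrow> (\<exists>A. lb a = Plain A \<and> lb c = Plain (OfCourse A))"
| "link_ok lb (LPara a c) \<longleftrightarrow> (\<exists>A. lb a = Plain A \<and> lb c = Plain (Para A))"

text \<open>All edges and links, at every depth, live in one graph. For an of course link \<open>l\<close>,
  \<open>box N l\<close> is the set of the links of the subnet bordered by \<open>l\<close> and its pax links, the
  bordering links themselves excluded; \<open>box N l\<close> is irrelevant for any other \<open>l\<close>.\<close>

record 'e net =
  edges :: "'e set"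
  lab :: "'e \<Rightarrow> label"
  links :: "'e link set"
  box :: "'e link \<Rightarrow> 'e link set"

definition is_ofcourse :: "'e link \<Rightarrow> bool" where
  "is_ofcourse l \<longleftrightarrow> (\<exists>a c. l = LOfCourse a c)"

definition is_pax :: "'e link \<Rightarrow> bool" where
  "is_pax l \<longleftrightarrow> (\<exists>a c. l = LPax a c)"

definition net_concls :: "'e net \<Rightarrow> 'e set" where
  "net_concls N = {e \<in> edges N. \<forall>l\<in>links N. e \<notin> prems l}"

definition border :: "'e net \<Rightarrow> 'e link \<Rightarrow> 'e link set" where
  "border N l = insert l
     {q \<in> links N. is_pax q \<and> q \<notin> box N l \<and> prems q \<subseteq> \<Union> (concls ` box N l)}"

definition box_ok :: "'e net \<Rightarrow> 'e link \<Rightarrow> bool" where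
  "box_ok N l \<longleftrightarrow>
     box N l \<subseteq> links N \<and> l \<notin> box N l \<and>
     prems l \<subseteq> \<Union> (concls ` box N l) \<and>
     (\<forall>k\<in>box N l. prems k \<subseteq> \<Union> (concls ` box N l)) \<and>
     (\<forall>e \<in> \<Union> (concls ` box N l). \<exists>k\<in>links N. e \<in> prems k \<and> (k \<in> box N l \<or> k \<in> border N l))"

definition is_net :: "'e net \<Rightarrow> bool" where
  "is_net N \<longleftrightarrow>
     finite (edges N) \<and> finite (links N) \<and>
     (\<forall>l\<in>links N. link_ok (lab N) l \<and> prems l \<union> concls l \<subseteq> edges N) \<and>
     (\<forall>e\<in>edges N. \<exists>!l. l \<in> links N \<and> e \<in> concls l) \<and>
     (\<forall>l\<in>links N. \<forall>l'\<in>links N. prems l \<inter> prems l' \<noteq> {} \<longrightarrow> l = l') \<and>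
     (\<forall>l\<in>links N. is_ofcourse l \<longrightarrow> box_ok N l) \<and>
     (\<forall>q\<in>links N. is_pax q \<longrightarrow> (\<exists>l\<in>links N. is_ofcourse l \<and> q \<in> border N l)) \<and>
     (\<forall>l\<in>links N. \<forall>l'\<in>links N. is_ofcourse l \<and> is_ofcourse l' \<and> l \<noteq> l' \<longrightarrow>
        (box N l \<union> border N l) \<inter> (box N l' \<union> border N l') = {} \<or>
        box N l \<union> border N l \<subseteq> box N l' \<or>
        box N l' \<union> border N l' \<subseteq> box N l)"


subsection \<open>Switchings and correctness\<close>

text \<open>In what follows \<open>S\<close> is a set of links forming a subnet of \<open>N\<close>: either all the links, or
  the content of a box. \<open>surface N S\<close> are its links lying in no box of \<open>S\<close>.\<close>

definition surface :: "'e net \<Rightarrow> 'e link set \<Rightarrow> 'e link set" where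
  "surface N S = S - \<Union> (box N ` {l \<in> S. is_ofcourse l})"

text \<open>The vertex carrying a surface link after collapsing the outermost boxes: a vertex is a set
  of links, namely the whole border of a box or a single link.\<close>

definition vertex :: "'e net \<Rightarrow> 'e link set \<Rightarrow> 'e link \<Rightarrow> 'e link set" where
  "vertex N S l =
     insert l (\<Union> (border N ` {k \<in> surface N S. is_ofcourse k \<and> l \<in> border N k}))"

definition is_switched :: "'e link \<Rightarrow> bool" where
  "is_switched l \<longleftrightarrow> (\<exists>a b c. l = LPar a b c) \<or> (\<exists>P c. l = LWhyNot P c)"

definition switching :: "'e link set \<Rightarrow> ('e link \<Rightarrow> 'e) \<Rightarrow> bool" where
  "switching S \<phi> \<longleftrightarrow> (\<forall>l\<in>S. is_switched l \<and> prems l \<noteq> {} \<longrightarrow> \<phi> l \<in> prems l)"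

text \<open>\<open>joins N S \<phi> e u v\<close>: in the undirected multigraph obtained from \<open>S\<close> by the switching
  \<open>\<phi>\<close>, the edge \<open>e\<close> joins the vertices \<open>u\<close> and \<open>v\<close>.\<close>

definition joins ::
  "'e net \<Rightarrow> 'e link set \<Rightarrow> ('e link \<Rightarrow> 'e) \<Rightarrow> 'e \<Rightarrow> 'e link set \<Rightarrow> 'e link set \<Rightarrow> bool" where
  "joins N S \<phi> e u v \<longleftrightarrow>
     (\<exists>l\<in>surface N S. \<exists>l'\<in>surface N S.
        e \<in> concls l \<and> e \<in> prems l' \<and> (is_switched l' \<longrightarrow> e = \<phi> l') \<and>
        {u, v} = {vertex N S l, vertex N S l'})"

definition switching_cycle ::
  "'e net \<Rightarrow> 'e link set \<Rightarrow> ('e link \<Rightarrow> 'e) \<Rightarrow> 'e list \<Rightarrow> 'e link set list \<Rightarrow> bool" where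
  "switching_cycle N S \<phi> es vs \<longleftrightarrow>
     es \<noteq> [] \<and> length vs = length es \<and> distinct es \<and> distinct vs \<and>
     (\<forall>i<length es. joins N S \<phi> (es ! i) (vs ! i) (vs ! (Suc i mod length es)))"

definition switching_acyclic :: "'e net \<Rightarrow> 'e link set \<Rightarrow> bool" where
  "switching_acyclic N S \<longleftrightarrow>
     (\<forall>\<phi>. switching S \<phi> \<longrightarrow> (\<nexists>es vs. switching_cycle N S \<phi> es vs))"

definition DR_net :: "'e net \<Rightarrow> bool" where
  "DR_net N \<longleftrightarrow>
     is_net N \<and>
     switching_acyclic N (links N) \<and>
     (\<forall>l\<in>links N. is_ofcourse l \<longrightarrow> switching_acyclic N (box N l)) \<and>
     (\<forall>e\<in>net_concls N. \<exists>A. lab N e = Plain A)"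

definition of_conclusion :: "'e net \<Rightarrow> form \<Rightarrow> bool" where
  "of_conclusion N A \<longleftrightarrow> (\<exists>e. net_concls N = {e} \<and> lab N e = Plain A)"


subsection \<open>Exponential indexings\<close>

primrec index_ok :: "('e \<Rightarrow> int) \<Rightarrow> 'e link \<Rightarrow> bool" where
  "index_ok I (LAx a b) \<longleftrightarrow> I a = I b"
| "index_ok I (LCut a b) \<longleftrightarrow> I a = I b"
| "index_ok I (LOne c) \<longleftrightarrow> True"
| "index_ok I (LBot c) \<longleftrightarrow> True"
| "index_ok I (LTensor a b c) \<longleftrightarrow> I a = I c \<and> I b = I c"
| "index_ok I (LPar a b c) \<longleftrightarrow> I a = I c \<and> I b = I c"
| "index_ok I (LFlat a c) \<longleftrightarrow> I a = I c"
| "index_ok I (LPax a c) \<longleftrightarrow> I a = I c"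
| "index_ok I (LWhyNot S c) \<longleftrightarrow> (\<forall>a\<in>S. I a = I c + 1)"
| "index_ok I (LOfCourse a c) \<longleftrightarrow> I a = I c + 1"
| "index_ok I (LPara a c) \<longleftrightarrow> I a = I c + 1"

definition exponential_indexing :: "'e net \<Rightarrow> ('e \<Rightarrow> int) \<Rightarrow> bool" where
  "exponential_indexing N I \<longleftrightarrow>
     (\<forall>l\<in>links N. index_ok I l) \<and>
     (\<forall>e\<in>net_concls N. \<forall>e'\<in>net_concls N. I e = I e')"

definition L3 :: "'e net set" where
  "L3 = {N. DR_net N \<and> (\<exists>I. exponential_indexing N I)}"


section \<open>Models of linear logic\<close>

subsection \<open>Categories\<close>

text \<open>Hom-sets are not required to be pairwise disjoint, so that the same arrow may be a morphism
  between several pairs of objects.\<close>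

record ('o, 'a) cat =
  Obj :: "'o set"
  Hom :: "'o \<Rightarrow> 'o \<Rightarrow> 'a set"
  Idn :: "'o \<Rightarrow> 'a"
  Cmp :: "'a \<Rightarrow> 'a \<Rightarrow> 'a"  (infixl \<open>\<cdot>\<index>\<close> 65)

locale category =
  fixes C :: "('o, 'a, 'z) cat_scheme" (structure)
  assumes Idn_hom: "A \<in> Obj C \<Longrightarrow> Idn C A \<in> Hom C A A"
    and Cmp_hom: "\<lbrakk>A \<in> Obj C; B \<in> Obj C; D \<in> Obj C; f \<in> Hom C A B; g \<in> Hom C B D\<rbrakk>
      \<Longrightarrow> g \<cdot> f \<in> Hom C A D"
    and Idn_left: "\<lbrakk>A \<in> Obj C; B \<in> Obj C; f \<in> Hom C A B\<rbrakk> \<Longrightarrow> Idn C B \<cdot> f = f"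
    and Idn_right: "\<lbrakk>A \<in> Obj C; B \<in> Obj C; f \<in> Hom C A B\<rbrakk> \<Longrightarrow> f \<cdot> Idn C A = f"
    and Cmp_assoc: "\<lbrakk>A \<in> Obj C; B \<in> Obj C; D \<in> Obj C; E \<in> Obj C;
      f \<in> Hom C A B; g \<in> Hom C B D; h \<in> Hom C D E\<rbrakk> \<Longrightarrow> h \<cdot> g \<cdot> f = h \<cdot> (g \<cdot> f)"

definition is_inverse :: "('o, 'a, 'z) cat_scheme \<Rightarrow> 'o \<Rightarrow> 'o \<Rightarrow> 'a \<Rightarrow> 'a \<Rightarrow> bool" where
  "is_inverse C A B f g \<longleftrightarrow>
     f \<in> Hom C A B \<and> g \<in> Hom C B A \<and> g \<cdot>\<^bsub>C\<^esub> f = Idn C A \<and> f \<cdot>\<^bsub>C\<^esub> g = Idn C B"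

definition is_iso :: "('o, 'a, 'z) cat_scheme \<Rightarrow> 'o \<Rightarrow> 'o \<Rightarrow> 'a \<Rightarrow> bool" where
  "is_iso C A B f \<longleftrightarrow> (\<exists>g. is_inverse C A B f g)"

definition inv_arr :: "('o, 'a, 'z) cat_scheme \<Rightarrow> 'o \<Rightarrow> 'o \<Rightarrow> 'a \<Rightarrow> 'a" where
  "inv_arr C A B f = (THE g. is_inverse C A B f g)"

definition is_terminal :: "('o, 'a, 'z) cat_scheme \<Rightarrow> 'o \<Rightarrow> bool" where
  "is_terminal C T \<longleftrightarrow> T \<in> Obj C \<and> (\<forall>A\<in>Obj C. \<exists>!f. f \<in> Hom C A T)"

definition is_product :: "('o, 'a, 'z) cat_scheme \<Rightarrow> 'o \<Rightarrow> 'o \<Rightarrow> 'o \<Rightarrow> 'a \<Rightarrow> 'a \<Rightarrow> bool" where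
  "is_product C A B P p q \<longleftrightarrow>
     P \<in> Obj C \<and> p \<in> Hom C P A \<and> q \<in> Hom C P B \<and>
     (\<forall>X\<in>Obj C. \<forall>f\<in>Hom C X A. \<forall>g\<in>Hom C X B.
        \<exists>!h. h \<in> Hom C X P \<and> p \<cdot>\<^bsub>C\<^esub> h = f \<and> q \<cdot>\<^bsub>C\<^esub> h = g)"

definition has_products :: "('o, 'a, 'z) cat_scheme \<Rightarrow> bool" where
  "has_products C \<longleftrightarrow>
     (\<exists>T. is_terminal C T) \<and> (\<forall>A\<in>Obj C. \<forall>B\<in>Obj C. \<exists>P p q. is_product C A B P p q)"

locale cat_functor =
  fixes C :: "('o, 'a, 'y) cat_scheme" and D :: "('p, 'b, 'z) cat_scheme"
    and FO :: "'o \<Rightarrow> 'p" and FA :: "'a \<Rightarrow> 'b"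
  assumes FO_obj: "A \<in> Obj C \<Longrightarrow> FO A \<in> Obj D"
    and FA_hom: "\<lbrakk>A \<in> Obj C; B \<in> Obj C; f \<in> Hom C A B\<rbrakk> \<Longrightarrow> FA f \<in> Hom D (FO A) (FO B)"
    and FA_Idn: "A \<in> Obj C \<Longrightarrow> FA (Idn C A) = Idn D (FO A)"
    and FA_Cmp: "\<lbrakk>A \<in> Obj C; B \<in> Obj C; E \<in> Obj C; f \<in> Hom C A B; g \<in> Hom C B E\<rbrakk>
      \<Longrightarrow> FA (g \<cdot>\<^bsub>C\<^esub> f) = FA g \<cdot>\<^bsub>D\<^esub> FA f"


subsection \<open>Symmetric monoidal, Cartesian and *-autonomous categories\<close>

record ('o, 'a) smcat = "('o, 'a) cat" +
  Unt :: 'o  (\<open>\<one>\<index>\<close>)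
  Ten :: "'o \<Rightarrow> 'o \<Rightarrow> 'o"  (infixr \<open>\<otimes>\<index>\<close> 75)
  TenA :: "'a \<Rightarrow> 'a \<Rightarrow> 'a"  (infixr \<open>\<odot>\<index>\<close> 75)
  Asc :: "'o \<Rightarrow> 'o \<Rightarrow> 'o \<Rightarrow> 'a"
  Lun :: "'o \<Rightarrow> 'a"
  Run :: "'o \<Rightarrow> 'a"
  Sym :: "'o \<Rightarrow> 'o \<Rightarrow> 'a"

locale symmetric_monoidal = category C
  for C :: "('o, 'a, 'z) smcat_scheme" (structure) +
  assumes Unt_obj: "\<one> \<in> Obj C"
    and Ten_obj: "\<lbrakk>A \<in> Obj C; B \<in> Obj C\<rbrakk> \<Longrightarrow> A \<otimes> B \<in> Obj C"
    and TenA_hom: "\<lbrakk>A \<in> Obj C; B \<in> Obj C; A' \<in> Obj C; B' \<in> Obj C;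
      f \<in> Hom C A A'; g \<in> Hom C B B'\<rbrakk> \<Longrightarrow> f \<odot> g \<in> Hom C (A \<otimes> B) (A' \<otimes> B')"
    and TenA_Idn: "\<lbrakk>A \<in> Obj C; B \<in> Obj C\<rbrakk> \<Longrightarrow> Idn C A \<odot> Idn C B = Idn C (A \<otimes> B)"
    and TenA_Cmp: "\<lbrakk>A \<in> Obj C; B \<in> Obj C; A' \<in> Obj C; B' \<in> Obj C; A'' \<in> Obj C; B'' \<in> Obj C;
      f \<in> Hom C A A'; g \<in> Hom C B B'; f' \<in> Hom C A' A''; g' \<in> Hom C B' B''\<rbrakk>
      \<Longrightarrow> (f' \<cdot> f) \<odot> (g' \<cdot> g) = (f' \<odot> g') \<cdot> (f \<odot> g)"
    and Asc_iso: "\<lbrakk>A \<in> Obj C; B \<in> Obj C; D \<in> Obj C\<rbrakk>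
      \<Longrightarrow> is_iso C ((A \<otimes> B) \<otimes> D) (A \<otimes> (B \<otimes> D)) (Asc C A B D)"
    and Lun_iso: "A \<in> Obj C \<Longrightarrow> is_iso C (\<one> \<otimes> A) A (Lun C A)"
    and Run_iso: "A \<in> Obj C \<Longrightarrow> is_iso C (A \<otimes> \<one>) A (Run C A)"
    and Sym_hom: "\<lbrakk>A \<in> Obj C; B \<in> Obj C\<rbrakk> \<Longrightarrow> Sym C A B \<in> Hom C (A \<otimes> B) (B \<otimes> A)"
    and Sym_Sym: "\<lbrakk>A \<in> Obj C; B \<in> Obj C\<rbrakk> \<Longrightarrow> Sym C B A \<cdot> Sym C A B = Idn C (A \<otimes> B)"
    and Asc_natural: "\<lbrakk>A \<in> Obj C; B \<in> Obj C; D \<in> Obj C; A' \<in> Obj C; B' \<in> Obj C; D' \<in> Obj C;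
      f \<in> Hom C A A'; g \<in> Hom C B B'; h \<in> Hom C D D'\<rbrakk>
      \<Longrightarrow> Asc C A' B' D' \<cdot> ((f \<odot> g) \<odot> h) = (f \<odot> (g \<odot> h)) \<cdot> Asc C A B D"
    and Lun_natural: "\<lbrakk>A \<in> Obj C; B \<in> Obj C; f \<in> Hom C A B\<rbrakk>
      \<Longrightarrow> Lun C B \<cdot> (Idn C \<one> \<odot> f) = f \<cdot> Lun C A"
    and Run_natural: "\<lbrakk>A \<in> Obj C; B \<in> Obj C; f \<in> Hom C A B\<rbrakk>
      \<Longrightarrow> Run C B \<cdot> (f \<odot> Idn C \<one>) = f \<cdot> Run C A"
    and Sym_natural: "\<lbrakk>A \<in> Obj C; B \<in> Obj C; A' \<in> Obj C; B' \<in> Obj C;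
      f \<in> Hom C A A'; g \<in> Hom C B B'\<rbrakk> \<Longrightarrow> Sym C A' B' \<cdot> (f \<odot> g) = (g \<odot> f) \<cdot> Sym C A B"
    and pentagon: "\<lbrakk>A \<in> Obj C; B \<in> Obj C; D \<in> Obj C; E \<in> Obj C\<rbrakk>
      \<Longrightarrow> Asc C A B (D \<otimes> E) \<cdot> Asc C (A \<otimes> B) D E =
          (Idn C A \<odot> Asc C B D E) \<cdot> Asc C A (B \<otimes> D) E \<cdot> (Asc C A B D \<odot> Idn C E)"
    and triangle: "\<lbrakk>A \<in> Obj C; B \<in> Obj C\<rbrakk>
      \<Longrightarrow> (Idn C A \<odot> Lun C B) \<cdot> Asc C A \<one> B = Run C A \<odot> Idn C B"
    and hexagon: "\<lbrakk>A \<in> Obj C; B \<in> Obj C; D \<in> Obj C\<rbrakk>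
      \<Longrightarrow> Asc C B D A \<cdot> Sym C A (B \<otimes> D) \<cdot> Asc C A B D =
          (Idn C B \<odot> Sym C A D) \<cdot> Asc C B A D \<cdot> (Sym C A B \<odot> Idn C D)"

definition to_unit :: "('o, 'a, 'z) smcat_scheme \<Rightarrow> 'o \<Rightarrow> 'a" where
  "to_unit C A = (THE f. f \<in> Hom C A \<one>\<^bsub>C\<^esub>)"

definition proj1 :: "('o, 'a, 'z) smcat_scheme \<Rightarrow> 'o \<Rightarrow> 'o \<Rightarrow> 'a" where
  "proj1 C A B = Run C A \<cdot>\<^bsub>C\<^esub> (Idn C A \<odot>\<^bsub>C\<^esub> to_unit C B)"

definition proj2 :: "('o, 'a, 'z) smcat_scheme \<Rightarrow> 'o \<Rightarrow> 'o \<Rightarrow> 'a" where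
  "proj2 C A B = Lun C B \<cdot>\<^bsub>C\<^esub> (to_unit C A \<odot>\<^bsub>C\<^esub> Idn C B)"

text \<open>A Cartesian category, with its canonical symmetric monoidal structure: the unit is terminal
  and the tensor, with the projections obtained by erasing a factor, is the product.\<close>

locale cartesian = symmetric_monoidal C
  for C :: "('o, 'a, 'z) smcat_scheme" (structure) +
  assumes Unt_terminal: "is_terminal C \<one>"
    and Ten_product: "\<lbrakk>A \<in> Obj C; B \<in> Obj C\<rbrakk>
      \<Longrightarrow> is_product C A B (A \<otimes> B) (proj1 C A B) (proj2 C A B)"

definition diagonal :: "('o, 'a, 'z) smcat_scheme \<Rightarrow> 'o \<Rightarrow> 'a" where
  "diagonal C A = (THE h. h \<in> Hom C A (A \<otimes>\<^bsub>C\<^esub> A) \<and>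
     proj1 C A A \<cdot>\<^bsub>C\<^esub> h = Idn C A \<and> proj2 C A A \<cdot>\<^bsub>C\<^esub> h = Idn C A)"

text \<open>\<open>Cur C A X B\<close> maps \<open>A \<otimes> X \<rightarrow> B\<close> to \<open>X \<rightarrow> Lol C A B\<close>, where
  \<open>Ev C A B : A \<otimes> Lol C A B \<rightarrow> B\<close>.\<close>

record ('o, 'a) starcat = "('o, 'a) smcat" +
  Lol :: "'o \<Rightarrow> 'o \<Rightarrow> 'o"
  Ev :: "'o \<Rightarrow> 'o \<Rightarrow> 'a"
  Cur :: "'o \<Rightarrow> 'o \<Rightarrow> 'o \<Rightarrow> 'a \<Rightarrow> 'a"
  Btm :: 'o

definition dual :: "('o, 'a, 'z) starcat_scheme \<Rightarrow> 'o \<Rightarrow> 'o" where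
  "dual C A = Lol C A (Btm C)"

definition dual_arr :: "('o, 'a, 'z) starcat_scheme \<Rightarrow> 'o \<Rightarrow> 'o \<Rightarrow> 'a \<Rightarrow> 'a" where
  "dual_arr C A B f =
     Cur C A (dual C B) (Btm C) (Ev C B (Btm C) \<cdot>\<^bsub>C\<^esub> (f \<odot>\<^bsub>C\<^esub> Idn C (dual C B)))"

definition to_bidual :: "('o, 'a, 'z) starcat_scheme \<Rightarrow> 'o \<Rightarrow> 'a" where
  "to_bidual C A =
     Cur C (dual C A) A (Btm C) (Ev C A (Btm C) \<cdot>\<^bsub>C\<^esub> Sym C (dual C A) A)"

locale star_autonomous = symmetric_monoidal C
  for C :: "('o, 'a, 'z) starcat_scheme" (structure) +
  assumes Lol_obj: "\<lbrakk>A \<in> Obj C; B \<in> Obj C\<rbrakk> \<Longrightarrow> Lol C A B \<in> Obj C"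
    and Ev_hom: "\<lbrakk>A \<in> Obj C; B \<in> Obj C\<rbrakk> \<Longrightarrow> Ev C A B \<in> Hom C (A \<otimes> Lol C A B) B"
    and Cur_hom: "\<lbrakk>A \<in> Obj C; X \<in> Obj C; B \<in> Obj C; f \<in> Hom C (A \<otimes> X) B\<rbrakk>
      \<Longrightarrow> Cur C A X B f \<in> Hom C X (Lol C A B)"
    and Ev_Cur: "\<lbrakk>A \<in> Obj C; X \<in> Obj C; B \<in> Obj C; f \<in> Hom C (A \<otimes> X) B\<rbrakk>
      \<Longrightarrow> Ev C A B \<cdot> (Idn C A \<odot> Cur C A X B f) = f"
    and Cur_Ev: "\<lbrakk>A \<in> Obj C; X \<in> Obj C; B \<in> Obj C; g \<in> Hom C X (Lol C A B)\<rbrakk>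
      \<Longrightarrow> Cur C A X B (Ev C A B \<cdot> (Idn C A \<odot> g)) = g"
    and Btm_obj: "Btm C \<in> Obj C"
    and to_bidual_iso: "A \<in> Obj C \<Longrightarrow> is_iso C A (dual C (dual C A)) (to_bidual C A)"


subsection \<open>Symmetric monoidal adjunctions\<close>

locale symmetric_monoidal_functor = cat_functor C D FO FA
  for C :: "('o, 'a, 'y) smcat_scheme" and D :: "('p, 'b, 'z) smcat_scheme"
    and FO :: "'o \<Rightarrow> 'p" and FA :: "'a \<Rightarrow> 'b" +
  fixes \<mu> :: "'o \<Rightarrow> 'o \<Rightarrow> 'b" and \<mu>0 :: 'b
  assumes \<mu>_hom: "\<lbrakk>A \<in> Obj C; B \<in> Obj C\<rbrakk>
      \<Longrightarrow> \<mu> A B \<in> Hom D (FO A \<otimes>\<^bsub>D\<^esub> FO B) (FO (A \<otimes>\<^bsub>C\<^esub> B))"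
    and \<mu>0_hom: "\<mu>0 \<in> Hom D \<one>\<^bsub>D\<^esub> (FO \<one>\<^bsub>C\<^esub>)"
    and \<mu>_natural: "\<lbrakk>A \<in> Obj C; B \<in> Obj C; A' \<in> Obj C; B' \<in> Obj C;
      f \<in> Hom C A A'; g \<in> Hom C B B'\<rbrakk>
      \<Longrightarrow> \<mu> A' B' \<cdot>\<^bsub>D\<^esub> (FA f \<odot>\<^bsub>D\<^esub> FA g) = FA (f \<odot>\<^bsub>C\<^esub> g) \<cdot>\<^bsub>D\<^esub> \<mu> A B"
    and \<mu>_Asc: "\<lbrakk>A \<in> Obj C; B \<in> Obj C; E \<in> Obj C\<rbrakk>
      \<Longrightarrow> FA (Asc C A B E) \<cdot>\<^bsub>D\<^esub> \<mu> (A \<otimes>\<^bsub>C\<^esub> B) E \<cdot>\<^bsub>D\<^esub> (\<mu> A B \<odot>\<^bsub>D\<^esub> Idn D (FO E)) =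
          \<mu> A (B \<otimes>\<^bsub>C\<^esub> E) \<cdot>\<^bsub>D\<^esub> (Idn D (FO A) \<odot>\<^bsub>D\<^esub> \<mu> B E) \<cdot>\<^bsub>D\<^esub> Asc D (FO A) (FO B) (FO E)"
    and \<mu>_Lun: "A \<in> Obj C
      \<Longrightarrow> FA (Lun C A) \<cdot>\<^bsub>D\<^esub> \<mu> \<one>\<^bsub>C\<^esub> A \<cdot>\<^bsub>D\<^esub> (\<mu>0 \<odot>\<^bsub>D\<^esub> Idn D (FO A)) = Lun D (FO A)"
    and \<mu>_Run: "A \<in> Obj C
      \<Longrightarrow> FA (Run C A) \<cdot>\<^bsub>D\<^esub> \<mu> A \<one>\<^bsub>C\<^esub> \<cdot>\<^bsub>D\<^esub> (Idn D (FO A) \<odot>\<^bsub>D\<^esub> \<mu>0) = Run D (FO A)"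
    and \<mu>_Sym: "\<lbrakk>A \<in> Obj C; B \<in> Obj C\<rbrakk>
      \<Longrightarrow> FA (Sym C A B) \<cdot>\<^bsub>D\<^esub> \<mu> A B = \<mu> B A \<cdot>\<^bsub>D\<^esub> Sym D (FO A) (FO B)"

text \<open>The linear category is the \<open>starcat\<close> part of the record; \<open>Crt\<close> is the Cartesian category.
  \<open>LO\<close>, \<open>LA\<close> and \<open>MO\<close>, \<open>MA\<close> are the object and arrow parts of the two adjoints,
  \<open>LM\<close>, \<open>LM0\<close> and \<open>MM\<close>, \<open>MM0\<close> their monoidal structures.\<close>

record ('o, 'a, 'p, 'b) llm = "('o, 'a) starcat" +
  Crt :: "('p, 'b) smcat"
  LO :: "'p \<Rightarrow> 'o"
  LA :: "'b \<Rightarrow> 'a"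
  LM :: "'p \<Rightarrow> 'p \<Rightarrow> 'a"
  LM0 :: 'a
  MO :: "'o \<Rightarrow> 'p"
  MA :: "'a \<Rightarrow> 'b"
  MM :: "'o \<Rightarrow> 'o \<Rightarrow> 'b"
  MM0 :: 'b
  Eta :: "'p \<Rightarrow> 'b"
  Eps :: "'o \<Rightarrow> 'a"

locale ll_model =
  star_autonomous M +
  K: cartesian "Crt M" +
  L: symmetric_monoidal_functor "Crt M" M "LO M" "LA M" "LM M" "LM0 M" +
  R: symmetric_monoidal_functor M "Crt M" "MO M" "MA M" "MM M" "MM0 M"
  for M :: "('o, 'a, 'p, 'b) llm" (structure) +
  assumes products: "has_products M"
    and Eta_hom: "X \<in> Obj (Crt M) \<Longrightarrow> Eta M X \<in> Hom (Crt M) X (MO M (LO M X))"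
    and Eps_hom: "A \<in> Obj M \<Longrightarrow> Eps M A \<in> Hom M (LO M (MO M A)) A"
    and Eta_natural: "\<lbrakk>X \<in> Obj (Crt M); Y \<in> Obj (Crt M); u \<in> Hom (Crt M) X Y\<rbrakk>
      \<Longrightarrow> Eta M Y \<cdot>\<^bsub>Crt M\<^esub> u = MA M (LA M u) \<cdot>\<^bsub>Crt M\<^esub> Eta M X"
    and Eps_natural: "\<lbrakk>A \<in> Obj M; B \<in> Obj M; f \<in> Hom M A B\<rbrakk>
      \<Longrightarrow> Eps M B \<cdot> LA M (MA M f) = f \<cdot> Eps M A"
    and triangle_L: "X \<in> Obj (Crt M)
      \<Longrightarrow> Eps M (LO M X) \<cdot> LA M (Eta M X) = Idn M (LO M X)"
    and triangle_M: "A \<in> Obj M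
      \<Longrightarrow> MA M (Eps M A) \<cdot>\<^bsub>Crt M\<^esub> Eta M (MO M A) = Idn (Crt M) (MO M A)"
    and Eta_monoidal: "\<lbrakk>X \<in> Obj (Crt M); Y \<in> Obj (Crt M)\<rbrakk>
      \<Longrightarrow> MA M (LM M X Y) \<cdot>\<^bsub>Crt M\<^esub> MM M (LO M X) (LO M Y) \<cdot>\<^bsub>Crt M\<^esub> (Eta M X \<odot>\<^bsub>Crt M\<^esub> Eta M Y)
          = Eta M (X \<otimes>\<^bsub>Crt M\<^esub> Y)"
    and Eta_monoidal_unit: "MA M (LM0 M) \<cdot>\<^bsub>Crt M\<^esub> MM0 M = Eta M \<one>\<^bsub>Crt M\<^esub>"
    and Eps_monoidal: "\<lbrakk>A \<in> Obj M; B \<in> Obj M\<rbrakk>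
      \<Longrightarrow> Eps M (A \<otimes> B) \<cdot> LA M (MM M A B) \<cdot> LM M (MO M A) (MO M B) = Eps M A \<odot> Eps M B"
    and Eps_monoidal_unit: "Eps M \<one> \<cdot> LA M (MM0 M) \<cdot> LM0 M = Idn M \<one>"


section \<open>Interpretation of formulas\<close>

record 'o objalg =
  o_one :: 'o
  o_bot :: 'o
  o_ten :: "'o \<Rightarrow> 'o \<Rightarrow> 'o"
  o_dual :: "'o \<Rightarrow> 'o"
  o_bang :: "'o \<Rightarrow> 'o"
  o_para :: "'o \<Rightarrow> 'o"

primrec fint :: "'o objalg \<Rightarrow> (nat \<Rightarrow> 'o) \<Rightarrow> form \<Rightarrow> 'o" where
  "fint \<O> v (Var x) = v x"
| "fint \<O> v (NVar x) = o_dual \<O> (v x)"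
| "fint \<O> v One = o_one \<O>"
| "fint \<O> v Bottom = o_bot \<O>"
| "fint \<O> v (Tensor A B) = o_ten \<O> (fint \<O> v A) (fint \<O> v B)"
| "fint \<O> v (Parr A B) =
     o_dual \<O> (o_ten \<O> (o_dual \<O> (fint \<O> v A)) (o_dual \<O> (fint \<O> v B)))"
| "fint \<O> v (OfCourse A) = o_bang \<O> (fint \<O> v A)"
| "fint \<O> v (WhyNot A) = o_dual \<O> (o_bang \<O> (o_dual \<O> (fint \<O> v A)))"
| "fint \<O> v (Para A) = o_para \<O> (fint \<O> v A)"

definition bang :: "('o, 'a, 'p, 'b) llm \<Rightarrow> 'o \<Rightarrow> 'o" where
  "bang M A = LO M (MO M A)"

definition bang_arr :: "('o, 'a, 'p, 'b) llm \<Rightarrow> 'a \<Rightarrow> 'a" where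
  "bang_arr M f = LA M (MA M f)"

text \<open>The paragraph functor acts as the identity on underlying objects and on arrows, so it is
  invisible in the linear category; see \<open>fst_fint_inv_alg\<close> below.\<close>

definition lin_alg :: "('o, 'a, 'p, 'b) llm \<Rightarrow> 'o objalg" where
  "lin_alg M = \<lparr>o_one = \<one>\<^bsub>M\<^esub>, o_bot = Btm M, o_ten = Ten M, o_dual = dual M,
     o_bang = bang M, o_para = (\<lambda>A. A)\<rparr>"

definition Inv_obj :: "('o, 'a, 'z) cat_scheme \<Rightarrow> ('o \<times> (int \<Rightarrow> 'a)) set" where
  "Inv_obj C = {(A, s). A \<in> Obj C \<and> (\<forall>k. s k \<in> Hom C A A \<and> s k \<cdot>\<^bsub>C\<^esub> s k = Idn C A)}"

definition Inv :: "('o, 'a, 'z) cat_scheme \<Rightarrow> ('o \<times> (int \<Rightarrow> 'a), 'a) cat" where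
  "Inv C = \<lparr>Obj = Inv_obj C,
     Hom = (\<lambda>(A, s) (B, t). {f. (A, s) \<in> Inv_obj C \<and> (B, t) \<in> Inv_obj C \<and> f \<in> Hom C A B \<and>
       (\<forall>k. t k \<cdot>\<^bsub>C\<^esub> f \<cdot>\<^bsub>C\<^esub> s k = f)}),
     Idn = (\<lambda>(A, s). Idn C A),
     Cmp = Cmp C\<rparr>"

definition inv_alg :: "('o, 'a, 'p, 'b) llm \<Rightarrow> ('o \<times> (int \<Rightarrow> 'a)) objalg" where
  "inv_alg M = \<lparr>
     o_one = (\<one>\<^bsub>M\<^esub>, \<lambda>k. Idn M \<one>\<^bsub>M\<^esub>),
     o_bot = (Btm M, \<lambda>k. Idn M (Btm M)),
     o_ten = (\<lambda>(A, s) (B, t). (A \<otimes>\<^bsub>M\<^esub> B, \<lambda>k. s k \<odot>\<^bsub>M\<^esub> t k)),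
     o_dual = (\<lambda>(A, s). (dual M A, \<lambda>k. dual_arr M A A (s k))),
     o_bang = (\<lambda>(A, s). (bang M A, \<lambda>k. bang_arr M (s k))),
     o_para = (\<lambda>(A, s). (A, \<lambda>k. s (k - 1)))\<rparr>"

definition default_assignment :: "('o, 'a, 'p, 'b) llm \<Rightarrow> 'o \<Rightarrow> nat \<Rightarrow> 'o \<times> (int \<Rightarrow> 'a)" where
  "default_assignment M \<Xi> x =
     (\<Xi> \<otimes>\<^bsub>M\<^esub> \<Xi>, \<lambda>k. if k = 0 then Sym M \<Xi> \<Xi> else Idn M (\<Xi> \<otimes>\<^bsub>M\<^esub> \<Xi>))"

definition default_fint :: "('o, 'a, 'p, 'b) llm \<Rightarrow> 'o \<Rightarrow> form \<Rightarrow> 'o \<times> (int \<Rightarrow> 'a)" where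
  "default_fint M \<Xi> A = fint (inv_alg M) (default_assignment M \<Xi>) A"

lemma fst_fint_inv_alg:
  "fst (fint (inv_alg M) w A) = fint (lin_alg M) (\<lambda>x. fst (w x)) A"
  by (induction A) (auto simp: inv_alg_def lin_alg_def split: prod.splits)

lemma fint_lin_alg_plus_form: "fint (lin_alg M) v (plus_form A) = fint (lin_alg M) v A"
  by (induction A) (auto simp: lin_alg_def)


section \<open>Interpretation of nets\<close>

context
  fixes M :: "('o, 'a, 'p, 'b) llm" (structure)
begin

subsection \<open>Exponential structure\<close>

definition dereliction :: "'o \<Rightarrow> 'a" where
  "dereliction A = Eps M A"

definition digging :: "'o \<Rightarrow> 'a" where
  "digging A = LA M (Eta M (MO M A))"

definition bang_mon :: "'o \<Rightarrow> 'o \<Rightarrow> 'a" where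
  "bang_mon A B = LA M (MM M A B) \<cdot> LM M (MO M A) (MO M B)"

definition bang_mon0 :: 'a where
  "bang_mon0 = LA M (MM0 M) \<cdot> LM0 M"

text \<open>The comonoid structure of \<open>!A\<close> comes from that of \<open>M A\<close>, along the inverses
  \<open>L (X \<times> Y) \<rightarrow> L X \<otimes> L Y\<close> and \<open>L 1 \<rightarrow> 1\<close> of the monoidal structure of the left adjoint \<open>L\<close>.\<close>

definition contraction :: "'o \<Rightarrow> 'a" where
  "contraction A =
     inv_arr M (bang M A \<otimes> bang M A) (LO M (MO M A \<otimes>\<^bsub>Crt M\<^esub> MO M A)) (LM M (MO M A) (MO M A))
       \<cdot> LA M (diagonal (Crt M) (MO M A))"

definition weakening :: "'o \<Rightarrow> 'a" where
  "weakening A = inv_arr M \<one> (LO M \<one>\<^bsub>Crt M\<^esub>) (LM0 M) \<cdot> LA M (to_unit (Crt M) (MO M A))"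


subsection \<open>Linear negation\<close>

context
  fixes v :: "nat \<Rightarrow> 'o"
begin

abbreviation fobj :: "form \<Rightarrow> 'o" where
  "fobj A \<equiv> fint (lin_alg M) v A"

text \<open>The canonical isomorphisms \<open>dual (fobj (neg A)) \<rightarrow> fobj A\<close> and
  \<open>dual (fobj A) \<rightarrow> fobj (neg A)\<close>.\<close>

fun neg_iso :: "form \<Rightarrow> 'a" and neg_iso' :: "form \<Rightarrow> 'a" where
  "neg_iso (Var x) = inv_arr M (v x) (dual M (dual M (v x))) (to_bidual M (v x))"
| "neg_iso (NVar x) = Idn M (dual M (v x))"
| "neg_iso One = inv_arr M \<one> (dual M (Btm M)) (Cur M (Btm M) \<one> (Btm M) (Run M (Btm M)))"
| "neg_iso Bottom = Ev M \<one> (Btm M) \<cdot> inv_arr M (\<one> \<otimes> dual M \<one>) (dual M \<one>) (Lun M (dual M \<one>))"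
| "neg_iso (Tensor A B) =
     (let X = dual M (fobj (neg A)) \<otimes> dual M (fobj (neg B)) in
      (neg_iso A \<odot> neg_iso B) \<cdot> inv_arr M X (dual M (dual M X)) (to_bidual M X))"
| "neg_iso (Parr A B) =
     dual_arr M (dual M (fobj A) \<otimes> dual M (fobj B)) (fobj (neg A) \<otimes> fobj (neg B))
       (neg_iso' A \<odot> neg_iso' B)"
| "neg_iso (OfCourse A) =
     (let X = bang M (dual M (fobj (neg A))) in
      bang_arr M (neg_iso A) \<cdot> inv_arr M X (dual M (dual M X)) (to_bidual M X))"
| "neg_iso (WhyNot A) =
     dual_arr M (bang M (dual M (fobj A))) (bang M (fobj (neg A))) (bang_arr M (neg_iso' A))"
| "neg_iso (Para A) = neg_iso A"
| "neg_iso' (Var x) = Idn M (dual M (v x))"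
| "neg_iso' (NVar x) = inv_arr M (v x) (dual M (dual M (v x))) (to_bidual M (v x))"
| "neg_iso' One = Ev M \<one> (Btm M) \<cdot> inv_arr M (\<one> \<otimes> dual M \<one>) (dual M \<one>) (Lun M (dual M \<one>))"
| "neg_iso' Bottom = inv_arr M \<one> (dual M (Btm M)) (Cur M (Btm M) \<one> (Btm M) (Run M (Btm M)))"
| "neg_iso' (Tensor A B) =
     dual_arr M (dual M (fobj (neg A)) \<otimes> dual M (fobj (neg B))) (fobj A \<otimes> fobj B)
       (neg_iso A \<odot> neg_iso B)"
| "neg_iso' (Parr A B) =
     (let X = dual M (fobj A) \<otimes> dual M (fobj B) in
      (neg_iso' A \<odot> neg_iso' B) \<cdot> inv_arr M X (dual M (dual M X)) (to_bidual M X))"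
| "neg_iso' (OfCourse A) =
     dual_arr M (bang M (dual M (fobj (neg A)))) (bang M (fobj A)) (bang_arr M (neg_iso A))"
| "neg_iso' (WhyNot A) =
     (let X = bang M (dual M (fobj A)) in
      bang_arr M (neg_iso' A) \<cdot> inv_arr M X (dual M (dual M X)) (to_bidual M X))"
| "neg_iso' (Para A) = neg_iso' A"

lemma neg_iso'_eq: "neg_iso' A = neg_iso (neg A)"
  and "neg_iso A = neg_iso' (neg A)"
  by (induction A) (simp_all add: Let_def)


subsection \<open>Contexts\<close>

text \<open>A proof of the sequent \<open>A\<^sub>1, \<dots>, A\<^sub>n\<close> is interpreted as an arrow from the tensor product of the
  interpretations of the formulas \<open>neg A\<^sub>i\<close> to the dualizing object; \<open>Flat A\<close> is treated as
  \<open>WhyNot A\<close>.\<close>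

primrec lobj :: "label \<Rightarrow> 'o" where
  "lobj (Plain A) = fobj (neg A)"
| "lobj (Flat A) = bang M (fobj (neg A))"

primrec ctx :: "label list \<Rightarrow> 'o" where
  "ctx [] = \<one>"
| "ctx (x # xs) = lobj x \<otimes> ctx xs"

text \<open>\<open>split_ctx xs ys : ctx (xs @ ys) \<rightarrow> ctx xs \<otimes> ctx ys\<close>\<close>

primrec split_ctx :: "label list \<Rightarrow> label list \<Rightarrow> 'a" where
  "split_ctx [] ys = inv_arr M (\<one> \<otimes> ctx ys) (ctx ys) (Lun M (ctx ys))"
| "split_ctx (x # xs) ys =
     inv_arr M ((lobj x \<otimes> ctx xs) \<otimes> ctx ys) (lobj x \<otimes> (ctx xs \<otimes> ctx ys))
       (Asc M (lobj x) (ctx xs) (ctx ys)) \<cdot> (Idn M (lobj x) \<odot> split_ctx xs ys)"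

text \<open>\<open>swap_ctx xs a b ys : ctx (xs @ b # a # ys) \<rightarrow> ctx (xs @ a # b # ys)\<close>\<close>

primrec swap_ctx :: "label list \<Rightarrow> label \<Rightarrow> label \<Rightarrow> label list \<Rightarrow> 'a" where
  "swap_ctx [] a b ys =
     Asc M (lobj a) (lobj b) (ctx ys) \<cdot> (Sym M (lobj b) (lobj a) \<odot> Idn M (ctx ys)) \<cdot>
     inv_arr M ((lobj b \<otimes> lobj a) \<otimes> ctx ys) (lobj b \<otimes> (lobj a \<otimes> ctx ys))
       (Asc M (lobj b) (lobj a) (ctx ys))"
| "swap_ctx (x # xs) a b ys = Idn M (lobj x) \<odot> swap_ctx xs a b ys"

text \<open>\<open>contract_ctx A n ys : !(fobj (neg A)) \<otimes> ctx ys \<rightarrow> ctx (replicate n (Flat A) @ ys)\<close>\<close>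

primrec contract_ctx :: "form \<Rightarrow> nat \<Rightarrow> label list \<Rightarrow> 'a" where
  "contract_ctx A 0 ys = Lun M (ctx ys) \<cdot> (weakening (fobj (neg A)) \<odot> Idn M (ctx ys))"
| "contract_ctx A (Suc n) ys =
     (let N = bang M (fobj (neg A)) in
      (Idn M N \<odot> contract_ctx A n ys) \<cdot> Asc M N N (ctx ys) \<cdot>
      (contraction (fobj (neg A)) \<odot> Idn M (ctx ys)))"

text \<open>\<open>promote_ctx As : ctx (map Flat As) \<rightarrow> !(ctx (map Flat As))\<close>\<close>

primrec promote_ctx :: "form list \<Rightarrow> 'a" where
  "promote_ctx [] = bang_mon0"
| "promote_ctx (A # As) =
     bang_mon (bang M (fobj (neg A))) (ctx (map Flat As)) \<cdot>
     (digging (fobj (neg A)) \<odot> promote_ctx As)"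

text \<open>\<open>copair Z h : dual Z \<otimes> X \<rightarrow> Btm\<close> for \<open>h : X \<rightarrow> Z\<close>\<close>

definition copair :: "'o \<Rightarrow> 'a \<Rightarrow> 'a" where
  "copair Z h = Ev M Z (Btm M) \<cdot> Sym M (dual M Z) Z \<cdot> (Idn M (dual M Z) \<odot> h)"


subsection \<open>Sequentializations and their interpretation\<close>

text \<open>\<open>seq_int N \<Gamma> S f\<close>: the links \<open>S\<close> of \<open>N\<close>, with conclusions \<open>\<Gamma>\<close>, are the
  desequentialization of a sequent calculus proof (whose formula occurrences are named by the edges
  of \<open>N\<close>), the interpretation of which is \<open>f : ctx (map (lab N) \<Gamma>) \<rightarrow> Btm\<close>.

  Switching acyclicity without connectedness corresponds to sequent calculus with the two mix rules,
  for the empty sequent and for the juxtaposition of two proofs. A model of linear logic does not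
  necessarily interpret them; \<open>mix0 : 1 \<rightarrow> Btm\<close> and \<open>mix2 : Btm \<rightarrow> 1\<close> are optional arrows
  interpreting them when they are available.\<close>

inductive seq_int ::
  "'a option \<Rightarrow> 'a option \<Rightarrow> 'e net \<Rightarrow> 'e list \<Rightarrow> 'e link set \<Rightarrow> 'a \<Rightarrow> bool"
  for mix0 mix2 N where
  ax: "\<lbrakk>lab N a = Plain A; lab N b = Plain (neg A)\<rbrakk>
    \<Longrightarrow> seq_int mix0 mix2 N [a, b] {LAx a b}
          (Ev M (fobj (neg A)) (Btm M) \<cdot>
           (Idn M (fobj (neg A)) \<odot>
             (inv_arr M (dual M (fobj (neg A))) (fobj A) (neg_iso A) \<cdot> Run M (fobj A))))"
| cut: "\<lbrakk>lab N a = Plain A; lab N b = Plain (neg A);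
      seq_int mix0 mix2 N (a # \<Gamma>) S f; seq_int mix0 mix2 N (b # \<Delta>) T g;
      S \<inter> T = {}; LCut a b \<notin> S \<union> T\<rbrakk>
    \<Longrightarrow> seq_int mix0 mix2 N (\<Gamma> @ \<Delta>) (insert (LCut a b) (S \<union> T))
          (g \<cdot> ((neg_iso A \<cdot> Cur M (fobj (neg A)) (ctx (map (lab N) \<Gamma>)) (Btm M) f) \<odot>
                Idn M (ctx (map (lab N) \<Delta>))) \<cdot>
           split_ctx (map (lab N) \<Gamma>) (map (lab N) \<Delta>))"
| one: "lab N c = Plain One
    \<Longrightarrow> seq_int mix0 mix2 N [c] {LOne c} (Run M (Btm M))"
| bot: "\<lbrakk>lab N c = Plain Bottom; seq_int mix0 mix2 N \<Gamma> S f; LBot c \<notin> S\<rbrakk>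
    \<Longrightarrow> seq_int mix0 mix2 N (c # \<Gamma>) (insert (LBot c) S) (f \<cdot> Lun M (ctx (map (lab N) \<Gamma>)))"
| tensor: "\<lbrakk>lab N a = Plain A; lab N b = Plain B; lab N c = Plain (Tensor A B);
      seq_int mix0 mix2 N (a # \<Gamma>) S f; seq_int mix0 mix2 N (b # \<Delta>) T g;
      S \<inter> T = {}; LTensor a b c \<notin> S \<union> T\<rbrakk>
    \<Longrightarrow> seq_int mix0 mix2 N (c # \<Gamma> @ \<Delta>) (insert (LTensor a b c) (S \<union> T))
          (copair (dual M (fobj (neg A)) \<otimes> dual M (fobj (neg B)))
            ((Cur M (fobj (neg A)) (ctx (map (lab N) \<Gamma>)) (Btm M) f \<odot>
              Cur M (fobj (neg B)) (ctx (map (lab N) \<Delta>)) (Btm M) g) \<cdot>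
             split_ctx (map (lab N) \<Gamma>) (map (lab N) \<Delta>)))"
| par: "\<lbrakk>lab N a = Plain A; lab N b = Plain B; lab N c = Plain (Parr A B);
      seq_int mix0 mix2 N (a # b # \<Gamma>) S f; LPar a b c \<notin> S\<rbrakk>
    \<Longrightarrow> seq_int mix0 mix2 N (c # \<Gamma>) (insert (LPar a b c) S)
          (f \<cdot> Asc M (fobj (neg A)) (fobj (neg B)) (ctx (map (lab N) \<Gamma>)))"
| flat: "\<lbrakk>lab N a = Plain A; lab N c = Flat A;
      seq_int mix0 mix2 N (a # \<Gamma>) S f; LFlat a c \<notin> S\<rbrakk>
    \<Longrightarrow> seq_int mix0 mix2 N (c # \<Gamma>) (insert (LFlat a c) S)
          (f \<cdot> (dereliction (fobj (neg A)) \<odot> Idn M (ctx (map (lab N) \<Gamma>))))"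
| whynot: "\<lbrakk>\<forall>a\<in>set as. lab N a = Flat A; lab N c = Plain (WhyNot A);
      seq_int mix0 mix2 N (as @ \<Gamma>) S f; LWhyNot (set as) c \<notin> S\<rbrakk>
    \<Longrightarrow> seq_int mix0 mix2 N (c # \<Gamma>) (insert (LWhyNot (set as) c) S)
          (f \<cdot> contract_ctx A (length as) (map (lab N) \<Gamma>))"
| ofcourse: "\<lbrakk>lab N a = Plain A; lab N c = Plain (OfCourse A);
      map (lab N) ps = map Flat As; map (lab N) qs = map Flat As;
      seq_int mix0 mix2 N (a # ps) S f; box N (LOfCourse a c) = S;
      P = set (map2 LPax ps qs); LOfCourse a c \<notin> S; P \<inter> S = {}\<rbrakk>
    \<Longrightarrow> seq_int mix0 mix2 N (c # qs) (insert (LOfCourse a c) (P \<union> S))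
          (copair (bang M (dual M (fobj (neg A))))
            (bang_arr M (Cur M (fobj (neg A)) (ctx (map Flat As)) (Btm M) f) \<cdot> promote_ctx As))"
| para: "\<lbrakk>lab N a = Plain A; lab N c = Plain (Para A);
      seq_int mix0 mix2 N (a # \<Gamma>) S f; LPara a c \<notin> S\<rbrakk>
    \<Longrightarrow> seq_int mix0 mix2 N (c # \<Gamma>) (insert (LPara a c) S) f"
| exchange: "seq_int mix0 mix2 N (\<Gamma> @ a # b # \<Delta>) S f
    \<Longrightarrow> seq_int mix0 mix2 N (\<Gamma> @ b # a # \<Delta>) S
          (f \<cdot> swap_ctx (map (lab N) \<Gamma>) (lab N a) (lab N b) (map (lab N) \<Delta>))"
| mix_empty: "mix0 = Some m \<Longrightarrow> seq_int mix0 mix2 N [] {} m"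
| mix_binary: "\<lbrakk>mix2 = Some m; seq_int mix0 mix2 N \<Gamma> S f; seq_int mix0 mix2 N \<Delta> T g;
      S \<inter> T = {}\<rbrakk>
    \<Longrightarrow> seq_int mix0 mix2 N (\<Gamma> @ \<Delta>) (S \<union> T)
          (Lun M (Btm M) \<cdot> ((m \<cdot> f) \<odot> g) \<cdot> split_ctx (map (lab N) \<Gamma>) (map (lab N) \<Delta>))"

text \<open>\<open>net_int mix0 mix2 N g\<close>: \<open>g : 1 \<rightarrow> fobj A\<close> is the interpretation of the net \<open>N\<close> of
  conclusion \<open>A\<close>.\<close>

definition net_int :: "'a option \<Rightarrow> 'a option \<Rightarrow> 'e net \<Rightarrow> 'a \<Rightarrow> bool" where
  "net_int mix0 mix2 N g \<longleftrightarrow>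
     (\<exists>e A f. net_concls N = {e} \<and> lab N e = Plain A \<and> seq_int mix0 mix2 N [e] (links N) f \<and>
        g = neg_iso A \<cdot> Cur M (fobj (neg A)) \<one> (Btm M) f)"

end

definition mix_arrows :: "'a option \<Rightarrow> 'a option \<Rightarrow> bool" where
  "mix_arrows mix0 mix2 \<longleftrightarrow>
     (\<forall>m. mix0 = Some m \<longrightarrow> m \<in> Hom M \<one> (Btm M)) \<and>
     (\<forall>m. mix2 = Some m \<longrightarrow> m \<in> Hom M (Btm M) \<one>)"

definition nontrivial :: bool where
  "nontrivial \<longleftrightarrow>
     (\<exists>v A (N :: nat net) (N' :: nat net) g g'.
        (\<forall>x. v x \<in> Obj M) \<and>
        DR_net N \<and> DR_net N' \<and>
        (\<forall>e\<in>edges N. \<forall>B. lab N e \<in> {Plain B, Flat B} \<longrightarrow> para_free B) \<and>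
        (\<forall>e\<in>edges N'. \<forall>B. lab N' e \<in> {Plain B, Flat B} \<longrightarrow> para_free B) \<and>
        of_conclusion N A \<and> of_conclusion N' A \<and>
        net_int v None None N g \<and> net_int v None None N' g' \<and> g \<noteq> g')"

end

end

theory Submission
  imports Defs
begin

text \<open>All structural arrows of a model of linear logic are natural, so they are equivariant for
  involutions transported along the connectives; hence every sequent calculus rule preserves
  equivariance. In a net with an exponential indexing \<open>I\<close>, let the edge \<open>e\<close> labelled by \<open>A\<close> carry, for
  each \<open>k\<close>, the involution of index \<open>k - I e\<close> of the interpretation of \<open>plus_form A\<close>. The shift of
  the index by one across exponential and paragraph links is the shift performed by the paragraph
  functor, so the rules remain equivariant for these involutions. At the single conclusion \<open>e\<close> the
  number \<open>k - I e\<close> takes every integer value.\<close>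

section \<open>Equivariant arrows\<close>

text \<open>The interpretation of proofs applies \<open>inv_arr\<close> to many arrows: unit and
  associativity isomorphisms, bidual maps, \<open>neg_iso\<close>, the monoidal structure of the
  left adjoint. Naturality alone is therefore not enough: every arrow that gets inverted has to be
  an isomorphism, and then its inverse is equivariant automatically. Two of these isomorphisms are
  not axioms of the model and cost real work: the one between the unit and the dual of
  \<open>Btm\<close>, and the strength of the left adjoint.

  The sign in \<open>k - I e\<close> comes from two conventions. The paragraph functor puts
  \<open>s (k - 1)\<close> at place \<open>k\<close>, while an exponential or paragraph link has its
  premise at \<open>I c + 1\<close>. Reading the premise at \<open>k - (I c + 1)\<close> is thus
  reading it one place below the conclusion, which is exactly where the paragraph looks.\<close>

context category
begin

section \<open>Inverses and equivariance in a category\<close>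

lemma is_inverse_unique:
  assumes "A \<in> Obj C" "B \<in> Obj C" "is_inverse C A B f g" "is_inverse C A B f h"
  shows "g = h"
proof -
  have f: "f \<in> Hom C A B" and g: "g \<in> Hom C B A" "g \<cdot> f = Idn C A"
    and h: "h \<in> Hom C B A" "f \<cdot> h = Idn C B"
    using assms unfolding is_inverse_def by auto
  have "g = g \<cdot> (f \<cdot> h)" using Idn_right[OF assms(2,1) g(1)] h by simp
  also have "\<dots> = (g \<cdot> f) \<cdot> h"
    using Cmp_assoc[OF assms(2,1,2,1) h(1) f g(1)] by simp
  also have "\<dots> = h" using Idn_left[OF assms(2,1) h(1)] g by simp
  finally show ?thesis .
qed

lemma is_inverse_inv_arr:
  assumes "A \<in> Obj C" "B \<in> Obj C" "is_iso C A B f"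
  shows "is_inverse C A B f (inv_arr C A B f)"
  using assms is_inverse_unique[OF assms(1,2)] unfolding is_iso_def inv_arr_def
  by (metis (mono_tags, lifting) theI')

text \<open>Involutions are handled one index at a time: an object is a pair of an underlying object and a
  single involution, and \<open>Inv M\<close> is recovered by quantifying over the index.\<close>

definition iobj :: "'o \<times> 'a \<Rightarrow> bool" where
  "iobj X \<longleftrightarrow> fst X \<in> Obj C \<and> snd X \<in> Hom C (fst X) (fst X) \<and> snd X \<cdot> snd X = Idn C (fst X)"

text \<open>As involutions square to the identity, this commuting square is equivalent to the
  condition \<open>t \<cdot> f \<cdot> s = f\<close> of \<open>Inv\<close>, and squares paste under
  composition. Membership also carries \<open>iobj\<close> of both ends, so composition has no
  further side conditions.\<close>

definition ihom :: "'o \<times> 'a \<Rightarrow> 'o \<times> 'a \<Rightarrow> 'a set" where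
  "ihom X Y = {f \<in> Hom C (fst X) (fst Y). iobj X \<and> iobj Y \<and> snd Y \<cdot> f = f \<cdot> snd X}"

definition iiso :: "'o \<times> 'a \<Rightarrow> 'o \<times> 'a \<Rightarrow> 'a set" where
  "iiso X Y = {f \<in> ihom X Y. is_iso C (fst X) (fst Y) f}"

lemma iobjD:
  assumes "iobj X"
  shows "fst X \<in> Obj C" "snd X \<in> Hom C (fst X) (fst X)" "snd X \<cdot> snd X = Idn C (fst X)"
  using assms by (auto simp: iobj_def)

lemma ihomD:
  assumes "f \<in> ihom X Y"
  shows "iobj X" "iobj Y" "fst X \<in> Obj C" "fst Y \<in> Obj C" "f \<in> Hom C (fst X) (fst Y)"
    "snd X \<in> Hom C (fst X) (fst X)" "snd Y \<in> Hom C (fst Y) (fst Y)"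
    "snd Y \<cdot> f = f \<cdot> snd X"
  using assms by (auto simp: ihom_def iobj_def)

lemma iobj_Idn: "A \<in> Obj C \<Longrightarrow> iobj (A, Idn C A)"
  by (simp add: iobj_def Idn_hom Idn_left[OF _ _ Idn_hom])

lemma ihom_Idn: "iobj X \<Longrightarrow> Idn C (fst X) \<in> ihom X X"
  by (auto simp: ihom_def iobj_def Idn_hom Idn_left[of "fst X" "fst X"] Idn_right[of "fst X" "fst X"])

lemma ihom_Cmp:
  assumes f: "f \<in> ihom X Y" and g: "g \<in> ihom Y Z"
  shows "g \<cdot> f \<in> ihom X Z"
proof -
  note f' = ihomD[OF f] and g' = ihomD[OF g]
  have "snd Z \<cdot> (g \<cdot> f) = (snd Z \<cdot> g) \<cdot> f"
    using Cmp_assoc[OF f'(3,4) g'(4,4) f'(5) g'(5,7)] by simp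
  also have "\<dots> = g \<cdot> (snd Y \<cdot> f)"
    using Cmp_assoc[OF f'(3,4,4) g'(4) f'(5,7) g'(5)] g'(8) by simp
  also have "\<dots> = (g \<cdot> f) \<cdot> snd X"
    using Cmp_assoc[OF f'(3,3,4) g'(4) f'(6,5) g'(5)] f'(8) by simp
  finally show ?thesis
    using f' g' Cmp_hom[OF f'(3,4) g'(4) f'(5) g'(5)] by (simp add: ihom_def)
qed

lemma iiso_ihom: "f \<in> iiso X Y \<Longrightarrow> f \<in> ihom X Y"
  by (simp add: iiso_def)

lemma is_iso_Idn: "A \<in> Obj C \<Longrightarrow> is_iso C A A (Idn C A)"
  unfolding is_iso_def is_inverse_def using Idn_hom Idn_left by blast

lemma iiso_Idn: "iobj X \<Longrightarrow> Idn C (fst X) \<in> iiso X X"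
  by (simp add: iiso_def ihom_Idn is_iso_Idn iobj_def)

lemma is_iso_Cmp:
  assumes o: "A \<in> Obj C" "B \<in> Obj C" "D \<in> Obj C" and "is_iso C A B f" "is_iso C B D g"
  shows "is_iso C A D (g \<cdot> f)"
proof -
  obtain f' g' where f: "f \<in> Hom C A B" "f' \<in> Hom C B A" "f' \<cdot> f = Idn C A" "f \<cdot> f' = Idn C B"
    and g: "g \<in> Hom C B D" "g' \<in> Hom C D B" "g' \<cdot> g = Idn C B" "g \<cdot> g' = Idn C D"
    using assms unfolding is_iso_def is_inverse_def by blast
  have fg: "f' \<cdot> g' \<in> Hom C D A" "g \<cdot> f \<in> Hom C A D" using o f g Cmp_hom by blast+
  have "(f' \<cdot> g') \<cdot> (g \<cdot> f) = f' \<cdot> ((g' \<cdot> g) \<cdot> f)"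
    using Cmp_assoc[OF o(1,3,2,1) fg(2) g(2) f(2)] Cmp_assoc[OF o(1,2,3,2) f(1) g(1,2)] by simp
  also have "\<dots> = Idn C A" using f g Idn_left[OF o(1,2) f(1)] by simp
  finally have 1: "(f' \<cdot> g') \<cdot> (g \<cdot> f) = Idn C A" .
  have "(g \<cdot> f) \<cdot> (f' \<cdot> g') = g \<cdot> ((f \<cdot> f') \<cdot> g')"
    using Cmp_assoc[OF o(3,1,2,3) fg(1) f(1) g(1)] Cmp_assoc[OF o(3,2,1,2) g(2) f(2,1)] by simp
  also have "\<dots> = Idn C D" using f g Idn_left[OF o(3,2) g(2)] by simp
  finally show ?thesis using 1 fg unfolding is_iso_def is_inverse_def by blast
qed

lemma iiso_Cmp: "\<lbrakk>f \<in> iiso X Y; g \<in> iiso Y Z\<rbrakk> \<Longrightarrow> g \<cdot> f \<in> iiso X Z"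
  using is_iso_Cmp[of "fst X" "fst Y" "fst Z" f g] ihom_Cmp[of f X Y g Z]
  by (simp add: iiso_def) (simp add: ihom_def iobj_def)

text \<open>Insert \<open>?g \<cdot> f\<close> in front of \<open>snd X \<cdot> ?g\<close>, move the
  involution across \<open>f\<close>, and cancel \<open>f \<cdot> ?g\<close>. This is why
  \<open>iiso\<close> asks only for invertibility of the underlying arrow.\<close>

lemma iiso_inv_arr:
  assumes "f \<in> iiso X Y"
  shows "inv_arr C (fst X) (fst Y) f \<in> iiso Y X"
proof -
  let ?g = "inv_arr C (fst X) (fst Y) f"
  have f: "f \<in> ihom X Y" and i: "is_iso C (fst X) (fst Y) f" using assms by (auto simp: iiso_def)
  note f' = ihomD[OF f]
  have g: "is_inverse C (fst X) (fst Y) f ?g" using is_inverse_inv_arr f' i by blast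
  then have gh: "?g \<in> Hom C (fst Y) (fst X)" and gf: "?g \<cdot> f = Idn C (fst X)"
    and fg: "f \<cdot> ?g = Idn C (fst Y)" by (auto simp: is_inverse_def)
  have sg: "snd X \<cdot> ?g \<in> Hom C (fst Y) (fst X)" using Cmp_hom f' gh by blast
  have "snd X \<cdot> ?g = (?g \<cdot> f) \<cdot> (snd X \<cdot> ?g)" using Idn_left[OF _ _ sg] f' gf by simp
  also have "\<dots> = ?g \<cdot> ((f \<cdot> snd X) \<cdot> ?g)"
    using Cmp_assoc[OF f'(4,3,4,3) sg f'(5) gh] Cmp_assoc[OF f'(4,3,3,4) gh f'(6,5)] by simp
  also have "\<dots> = ?g \<cdot> (snd Y \<cdot> (f \<cdot> ?g))"
    using Cmp_assoc[OF f'(4,3,4,4) gh f'(5,7)] f'(8) by simp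
  also have "\<dots> = ?g \<cdot> snd Y" using Idn_right f' fg by simp
  finally have "?g \<in> ihom Y X" using f' gh by (simp add: ihom_def)
  moreover have "is_iso C (fst Y) (fst X) ?g" using g by (auto simp: is_iso_def is_inverse_def)
  ultimately show ?thesis by (simp add: iiso_def)
qed

end

section \<open>Equivariance of the symmetric monoidal structure\<close>

definition iten :: "('o, 'a, 'z) smcat_scheme \<Rightarrow> 'o \<times> 'a \<Rightarrow> 'o \<times> 'a \<Rightarrow> 'o \<times> 'a" where
  "iten C X Y = (fst X \<otimes>\<^bsub>C\<^esub> fst Y, snd X \<odot>\<^bsub>C\<^esub> snd Y)"

definition iunt :: "('o, 'a, 'z) smcat_scheme \<Rightarrow> 'o \<times> 'a" where
  "iunt C = (\<one>\<^bsub>C\<^esub>, Idn C \<one>\<^bsub>C\<^esub>)"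

lemma fst_iten [simp]: "fst (iten C X Y) = fst X \<otimes>\<^bsub>C\<^esub> fst Y"
  and fst_iunt [simp]: "fst (iunt C) = \<one>\<^bsub>C\<^esub>"
  by (simp_all add: iten_def iunt_def)

context symmetric_monoidal
begin

lemma interchange:
  assumes "A \<in> Obj C" "A' \<in> Obj C" "B \<in> Obj C" "B' \<in> Obj C" "f \<in> Hom C A A'" "g \<in> Hom C B B'"
  shows "(f \<odot> Idn C B') \<cdot> (Idn C A \<odot> g) = f \<odot> g" "(Idn C A' \<odot> g) \<cdot> (f \<odot> Idn C B) = f \<odot> g"
  using TenA_Cmp[OF assms(1,3,1,4,2,4) Idn_hom assms(6,5) Idn_hom]
    TenA_Cmp[OF assms(1,3,2,3,2,4) assms(5) Idn_hom Idn_hom assms(6)] assms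
  by (simp_all add: Idn_left Idn_right)

lemma iobj_iunt: "iobj (iunt C)"
  by (simp add: iunt_def iobj_Idn Unt_obj)

lemma iobj_iten:
  assumes "iobj X" "iobj Y"
  shows "iobj (iten C X Y)"
proof -
  note X = iobjD[OF assms(1)] and Y = iobjD[OF assms(2)]
  show ?thesis
    using X Y TenA_Cmp[OF X(1) Y(1) X(1) Y(1) X(1) Y(1) X(2) Y(2) X(2) Y(2)]
      TenA_hom[OF X(1) Y(1) X(1) Y(1) X(2) Y(2)] TenA_Idn[OF X(1) Y(1)]
    by (simp add: iobj_def iten_def Ten_obj)
qed

lemma ihom_TenA:
  assumes "f \<in> ihom X X'" "g \<in> ihom Y Y'"
  shows "f \<odot> g \<in> ihom (iten C X Y) (iten C X' Y')"
proof -
  note f = ihomD[OF assms(1)] and g = ihomD[OF assms(2)]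
  have "(snd X' \<odot> snd Y') \<cdot> (f \<odot> g) = (f \<odot> g) \<cdot> (snd X \<odot> snd Y)"
    using TenA_Cmp[OF f(3) g(3) f(4) g(4) f(4) g(4) f(5) g(5) f(7) g(7)]
      TenA_Cmp[OF f(3) g(3) f(3) g(3) f(4) g(4) f(6) g(6) f(5) g(5)] f(8) g(8) by simp
  then show ?thesis
    using TenA_hom[OF f(3) g(3) f(4) g(4) f(5) g(5)] iobj_iten f g
    by (simp add: ihom_def iten_def)
qed

lemma is_iso_TenA:
  assumes o: "A \<in> Obj C" "B \<in> Obj C" "A' \<in> Obj C" "B' \<in> Obj C"
    and "is_iso C A A' f" "is_iso C B B' g"
  shows "is_iso C (A \<otimes> B) (A' \<otimes> B') (f \<odot> g)"
proof -
  obtain f' g' where f: "f \<in> Hom C A A'" "f' \<in> Hom C A' A" "f' \<cdot> f = Idn C A" "f \<cdot> f' = Idn C A'"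
    and g: "g \<in> Hom C B B'" "g' \<in> Hom C B' B" "g' \<cdot> g = Idn C B" "g \<cdot> g' = Idn C B'"
    using assms unfolding is_iso_def is_inverse_def by blast
  have "is_inverse C (A \<otimes> B) (A' \<otimes> B') (f \<odot> g) (f' \<odot> g')"
    unfolding is_inverse_def
    using TenA_hom[OF o(1,2,3,4) f(1) g(1)] TenA_hom[OF o(3,4,1,2) f(2) g(2)]
      TenA_Cmp[OF o(1,2,3,4,1,2) f(1) g(1) f(2) g(2)] TenA_Cmp[OF o(3,4,1,2,3,4) f(2) g(2) f(1) g(1)]
      f g o TenA_Idn by simp
  then show ?thesis by (auto simp: is_iso_def)
qed

lemma iiso_TenA: "\<lbrakk>f \<in> iiso X X'; g \<in> iiso Y Y'\<rbrakk> \<Longrightarrow> f \<odot> g \<in> iiso (iten C X Y) (iten C X' Y')"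
  using is_iso_TenA[of "fst X" "fst Y" "fst X'" "fst Y'" f g] ihom_TenA[of f X X' g Y Y']
  by (simp add: iiso_def) (simp add: ihom_def iobj_def)

text \<open>Naturality of the associator, instantiated at the three involutions themselves, is its
  equivariance. The unit isomorphisms and the symmetry are treated in the same way.\<close>

lemma iiso_Asc:
  assumes "iobj X" "iobj Y" "iobj Z"
  shows "Asc C (fst X) (fst Y) (fst Z) \<in> iiso (iten C (iten C X Y) Z) (iten C X (iten C Y Z))"
  using assms Asc_iso[of "fst X" "fst Y" "fst Z"]
    Asc_natural[of "fst X" "fst Y" "fst Z" "fst X" "fst Y" "fst Z" "snd X" "snd Y" "snd Z"]
    iobj_iten
  by (auto simp: iiso_def ihom_def iobjD is_iso_def is_inverse_def) (simp add: iten_def)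

lemma iiso_Lun:
  assumes "iobj X"
  shows "Lun C (fst X) \<in> iiso (iten C (iunt C) X) X"
  using assms Lun_iso[of "fst X"] Lun_natural[of "fst X" "fst X" "snd X"] iobj_iten iobj_iunt
  by (auto simp: iiso_def ihom_def iobjD is_iso_def is_inverse_def) (simp add: iten_def iunt_def)

lemma iiso_Run:
  assumes "iobj X"
  shows "Run C (fst X) \<in> iiso (iten C X (iunt C)) X"
  using assms Run_iso[of "fst X"] Run_natural[of "fst X" "fst X" "snd X"] iobj_iten iobj_iunt
  by (auto simp: iiso_def ihom_def iobjD is_iso_def is_inverse_def) (simp add: iten_def iunt_def)

lemma ihom_Sym:
  assumes "iobj X" "iobj Y"
  shows "Sym C (fst X) (fst Y) \<in> ihom (iten C X Y) (iten C Y X)"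
  using assms Sym_hom Sym_natural[of "fst X" "fst Y" "fst X" "fst Y" "snd X" "snd Y"] iobj_iten
  by (auto simp: ihom_def iobjD) (simp add: iten_def iobjD)

end

section \<open>Duality and the dualizing object\<close>

definition idual :: "('o, 'a, 'z) starcat_scheme \<Rightarrow> 'o \<times> 'a \<Rightarrow> 'o \<times> 'a" where
  "idual C X = (dual C (fst X), dual_arr C (fst X) (fst X) (snd X))"

definition ibtm :: "('o, 'a, 'z) starcat_scheme \<Rightarrow> 'o \<times> 'a" where
  "ibtm C = (Btm C, Idn C (Btm C))"

lemma fst_idual [simp]: "fst (idual C X) = dual C (fst X)"
  and fst_ibtm [simp]: "fst (ibtm C) = Btm C"
  by (simp_all add: idual_def ibtm_def)

context star_autonomous
begin

lemma dual_obj: "A \<in> Obj C \<Longrightarrow> dual C A \<in> Obj C"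
  by (simp add: dual_def Lol_obj Btm_obj)

lemma Ev_dual_hom: "A \<in> Obj C \<Longrightarrow> Ev C A (Btm C) \<in> Hom C (A \<otimes> dual C A) (Btm C)"
  by (simp add: dual_def Ev_hom Btm_obj)

lemma Cur_dual_hom:
  "\<lbrakk>A \<in> Obj C; X \<in> Obj C; f \<in> Hom C (A \<otimes> X) (Btm C)\<rbrakk> \<Longrightarrow> Cur C A X (Btm C) f \<in> Hom C X (dual C A)"
  by (simp add: dual_def Cur_hom Btm_obj)

text \<open>The uniqueness half of currying: identities between arrows into a dual are checked after
  pairing with \<open>Ev\<close>.\<close>

lemma dual_hom_eqI:
  assumes "A \<in> Obj C" "X \<in> Obj C" "f \<in> Hom C X (dual C A)" "g \<in> Hom C X (dual C A)"
    and "Ev C A (Btm C) \<cdot> (Idn C A \<odot> f) = Ev C A (Btm C) \<cdot> (Idn C A \<odot> g)"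
  shows "f = g"
  using Cur_Ev[OF assms(1,2) Btm_obj assms(3)[unfolded dual_def]]
    Cur_Ev[OF assms(1,2) Btm_obj assms(4)[unfolded dual_def]] assms(5)
  by metis

lemma dual_arr_hom:
  assumes "A \<in> Obj C" "B \<in> Obj C" "f \<in> Hom C A B"
  shows "dual_arr C A B f \<in> Hom C (dual C B) (dual C A)"
    and "Ev C A (Btm C) \<cdot> (Idn C A \<odot> dual_arr C A B f) = Ev C B (Btm C) \<cdot> (f \<odot> Idn C (dual C B))"
proof -
  have "f \<odot> Idn C (dual C B) \<in> Hom C (A \<otimes> dual C B) (B \<otimes> dual C B)"
    using assms TenA_hom dual_obj Idn_hom by blast
  then have *: "Ev C B (Btm C) \<cdot> (f \<odot> Idn C (dual C B)) \<in> Hom C (A \<otimes> dual C B) (Btm C)"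
    by (meson Cmp_hom Ev_dual_hom Ten_obj Btm_obj assms dual_obj)
  show "dual_arr C A B f \<in> Hom C (dual C B) (dual C A)"
    unfolding dual_arr_def by (rule Cur_dual_hom[OF assms(1) dual_obj[OF assms(2)] *])
  show "Ev C A (Btm C) \<cdot> (Idn C A \<odot> dual_arr C A B f) = Ev C B (Btm C) \<cdot> (f \<odot> Idn C (dual C B))"
    unfolding dual_arr_def by (rule Ev_Cur[OF assms(1) dual_obj[OF assms(2)] Btm_obj *])
qed

lemma dual_arr_Idn:
  assumes "A \<in> Obj C"
  shows "dual_arr C A A (Idn C A) = Idn C (dual C A)"
  by (rule dual_hom_eqI[OF assms dual_obj[OF assms]])
     (use assms in \<open>simp_all add: dual_arr_hom dual_obj Idn_hom\<close>)

text \<open>Naturality of currying in the dualized variable; \<open>Cur_Cmp\<close> is its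
  counterpart for the parameter. Together they move involutions through \<open>Cur\<close> from
  either side.\<close>

lemma dual_arr_Cur:
  assumes o: "A \<in> Obj C" "B \<in> Obj C" "X \<in> Obj C"
    and f: "f \<in> Hom C A B" and g: "g \<in> Hom C (B \<otimes> X) (Btm C)"
  shows "dual_arr C A B f \<cdot> Cur C B X (Btm C) g = Cur C A X (Btm C) (g \<cdot> (f \<odot> Idn C X))"
proof -
  let ?d = "dual_arr C A B f" and ?c = "Cur C B X (Btm C) g"
  note do = o(1,2)[THEN dual_obj]
  note d = dual_arr_hom[OF o(1,2) f] and c = Cur_dual_hom[OF o(2,3) g]
  note i = o[THEN Idn_hom] and di = do[THEN Idn_hom]
  note eA = Ev_dual_hom[OF o(1)] and eB = Ev_dual_hom[OF o(2)]
  have gf: "g \<cdot> (f \<odot> Idn C X) \<in> Hom C (A \<otimes> X) (Btm C)"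
    by (rule Cmp_hom[OF Ten_obj Ten_obj Btm_obj TenA_hom g]) (fact o i f)+
  have "Ev C A (Btm C) \<cdot> (Idn C A \<odot> (?d \<cdot> ?c))
      = Ev C A (Btm C) \<cdot> ((Idn C A \<odot> ?d) \<cdot> (Idn C A \<odot> ?c))"
    using TenA_Cmp[OF o(1,3,1) do(2) o(1) do(1) i(1) c i(1) d(1)]
    by (simp add: Idn_left[OF o(1,1) i(1)])
  also have "\<dots> = (Ev C A (Btm C) \<cdot> (Idn C A \<odot> ?d)) \<cdot> (Idn C A \<odot> ?c)"
    by (rule Cmp_assoc[symmetric, OF Ten_obj Ten_obj Ten_obj Btm_obj TenA_hom TenA_hom eA])
       (fact o do i d c)+
  also have "\<dots> = Ev C B (Btm C) \<cdot> ((f \<odot> Idn C (dual C B)) \<cdot> (Idn C A \<odot> ?c))"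
    unfolding d(2)
    by (rule Cmp_assoc[OF Ten_obj Ten_obj Ten_obj Btm_obj TenA_hom TenA_hom eB])
       (fact o do i di c f)+
  also have "\<dots> = Ev C B (Btm C) \<cdot> ((Idn C B \<odot> ?c) \<cdot> (f \<odot> Idn C X))"
    using interchange[OF o do(2) f c] by simp
  also have "\<dots> = (Ev C B (Btm C) \<cdot> (Idn C B \<odot> ?c)) \<cdot> (f \<odot> Idn C X)"
    by (rule Cmp_assoc[symmetric, OF Ten_obj Ten_obj Ten_obj Btm_obj TenA_hom TenA_hom eB])
       (fact o do i di c f)+
  also have "\<dots> = g \<cdot> (f \<odot> Idn C X)"
    using Ev_Cur[OF o(2,3) Btm_obj g] by simp
  also have "\<dots> = Ev C A (Btm C) \<cdot> (Idn C A \<odot> Cur C A X (Btm C) (g \<cdot> (f \<odot> Idn C X)))"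
    using Ev_Cur[OF o(1,3) Btm_obj gf] by simp
  finally show ?thesis
    by (rule dual_hom_eqI[OF o(1,3) Cmp_hom[OF o(3) do(2,1) c d(1)] Cur_dual_hom[OF o(1,3) gf]])
qed

lemma Cur_Cmp:
  assumes o: "A \<in> Obj C" "X \<in> Obj C" "Y \<in> Obj C"
    and h: "h \<in> Hom C Y X" and g: "g \<in> Hom C (A \<otimes> X) (Btm C)"
  shows "Cur C A X (Btm C) g \<cdot> h = Cur C A Y (Btm C) (g \<cdot> (Idn C A \<odot> h))"
proof -
  let ?c = "Cur C A X (Btm C) g"
  note do = dual_obj[OF o(1)] and c = Cur_dual_hom[OF o(1,2) g]
  note i = Idn_hom[OF o(1)] and e = Ev_dual_hom[OF o(1)]
  have gh: "g \<cdot> (Idn C A \<odot> h) \<in> Hom C (A \<otimes> Y) (Btm C)"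
    by (rule Cmp_hom[OF Ten_obj Ten_obj Btm_obj TenA_hom g]) (fact o i h)+
  have "Ev C A (Btm C) \<cdot> (Idn C A \<odot> (?c \<cdot> h)) = Ev C A (Btm C) \<cdot> ((Idn C A \<odot> ?c) \<cdot> (Idn C A \<odot> h))"
    using TenA_Cmp[OF o(1,3,1,2,1) do i h i c] by (simp add: Idn_left[OF o(1,1) i])
  also have "\<dots> = (Ev C A (Btm C) \<cdot> (Idn C A \<odot> ?c)) \<cdot> (Idn C A \<odot> h)"
    by (rule Cmp_assoc[symmetric, OF Ten_obj Ten_obj Ten_obj Btm_obj TenA_hom TenA_hom e])
       (fact o do i h c)+
  also have "\<dots> = Ev C A (Btm C) \<cdot> (Idn C A \<odot> Cur C A Y (Btm C) (g \<cdot> (Idn C A \<odot> h)))"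
    using Ev_Cur[OF o(1,2) Btm_obj g] Ev_Cur[OF o(1,3) Btm_obj gh] by simp
  finally show ?thesis
    by (rule dual_hom_eqI[OF o(1,3) Cmp_hom[OF o(3,2) do h c] Cur_dual_hom[OF o(1,3) gh]])
qed

text \<open>\<open>dual_arr\<close> is itself a \<open>Cur\<close>, so this is
  \<open>dual_arr_Cur\<close> applied to the body of \<open>dual_arr C B D g\<close>.\<close>

lemma dual_arr_Cmp:
  assumes o: "A \<in> Obj C" "B \<in> Obj C" "D \<in> Obj C" and f: "f \<in> Hom C A B" and g: "g \<in> Hom C B D"
  shows "dual_arr C A D (g \<cdot> f) = dual_arr C A B f \<cdot> dual_arr C B D g"
proof -
  note dD = dual_obj[OF o(3)] and e = Ev_dual_hom[OF o(3)]
  note i = Idn_hom[OF dD]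
  have eg: "Ev C D (Btm C) \<cdot> (g \<odot> Idn C (dual C D)) \<in> Hom C (B \<otimes> dual C D) (Btm C)"
    by (rule Cmp_hom[OF Ten_obj Ten_obj Btm_obj TenA_hom e]) (fact o dD i g)+
  have "Ev C D (Btm C) \<cdot> (g \<odot> Idn C (dual C D)) \<cdot> (f \<odot> Idn C (dual C D))
      = Ev C D (Btm C) \<cdot> ((g \<odot> Idn C (dual C D)) \<cdot> (f \<odot> Idn C (dual C D)))"
    by (rule Cmp_assoc[OF Ten_obj Ten_obj Ten_obj Btm_obj TenA_hom TenA_hom e])
       (fact o dD i f g)+
  also have "\<dots> = Ev C D (Btm C) \<cdot> ((g \<cdot> f) \<odot> Idn C (dual C D))"
    using TenA_Cmp[OF o(1) dD o(2) dD o(3) dD f i g i] by (simp add: Idn_left[OF dD dD i])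
  finally show ?thesis
    using dual_arr_Cur[OF o(1,2) dD f eg] by (simp add: dual_arr_def)
qed

lemma iobj_ibtm: "iobj (ibtm C)"
  by (simp add: ibtm_def iobj_Idn Btm_obj)

lemma iobj_idual:
  assumes "iobj X"
  shows "iobj (idual C X)"
  using iobjD[OF assms] dual_arr_Cmp[of "fst X" "fst X" "fst X" "snd X" "snd X"]
  by (simp add: iobj_def idual_def dual_obj dual_arr_hom dual_arr_Idn)

lemma ihom_dual_arr:
  assumes "f \<in> ihom X Y"
  shows "dual_arr C (fst X) (fst Y) f \<in> ihom (idual C Y) (idual C X)"
proof -
  note f = ihomD[OF assms]
  show ?thesis
    using f dual_arr_Cmp[OF f(3,3,4,6,5)] dual_arr_Cmp[OF f(3,4,4,5,7)]
    by (simp add: ihom_def iobj_idual) (simp add: idual_def dual_arr_hom)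
qed

lemma iiso_dual_arr:
  assumes "f \<in> iiso X Y"
  shows "dual_arr C (fst X) (fst Y) f \<in> iiso (idual C Y) (idual C X)"
proof -
  obtain g where f: "f \<in> ihom X Y" and fg: "f \<in> Hom C (fst X) (fst Y)" "g \<in> Hom C (fst Y) (fst X)"
    "g \<cdot> f = Idn C (fst X)" "f \<cdot> g = Idn C (fst Y)"
    using assms unfolding iiso_def is_iso_def is_inverse_def by auto
  note f' = ihomD[OF f]
  have "is_inverse C (dual C (fst Y)) (dual C (fst X)) (dual_arr C (fst X) (fst Y) f)
      (dual_arr C (fst Y) (fst X) g)"
    unfolding is_inverse_def
    using f' fg dual_arr_Cmp[OF f'(3,4,3) fg(1,2)] dual_arr_Cmp[OF f'(4,3,4) fg(2,1)]
    by (simp add: dual_arr_hom dual_arr_Idn)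
  then show ?thesis using ihom_dual_arr[OF f] by (auto simp: iiso_def is_iso_def)
qed

text \<open>Transposition lets the involution of the dual act on the first factor instead, where it
  meets the one already there and cancels it.\<close>

lemma ihom_Ev:
  assumes "iobj X"
  shows "Ev C (fst X) (Btm C) \<in> ihom (iten C X (idual C X)) (ibtm C)"
proof -
  let ?s = "snd X" and ?d = "dual_arr C (fst X) (fst X) (snd X)" and ?A = "fst X"
  note X = iobjD[OF assms]
  note d = dual_arr_hom[OF X(1,1,2)]
  note do = dual_obj[OF X(1)] and i = Idn_hom[OF X(1)]
  note di = Idn_hom[OF do] and e = Ev_dual_hom[OF X(1)]
  have "Ev C ?A (Btm C) \<cdot> (?s \<odot> ?d) = Ev C ?A (Btm C) \<cdot> ((Idn C ?A \<odot> ?d) \<cdot> (?s \<odot> Idn C (dual C ?A)))"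
    using interchange(2)[OF X(1,1) do do X(2) d(1)] by simp
  also have "\<dots> = (Ev C ?A (Btm C) \<cdot> (Idn C ?A \<odot> ?d)) \<cdot> (?s \<odot> Idn C (dual C ?A))"
    by (rule Cmp_assoc[symmetric, OF Ten_obj Ten_obj Ten_obj Btm_obj TenA_hom TenA_hom e])
       (fact X do i di d)+
  also have "\<dots> = Ev C ?A (Btm C) \<cdot> ((?s \<odot> Idn C (dual C ?A)) \<cdot> (?s \<odot> Idn C (dual C ?A)))"
    unfolding d(2)
    by (rule Cmp_assoc[OF Ten_obj Ten_obj Ten_obj Btm_obj TenA_hom TenA_hom e])
       (fact X do i di d)+
  also have "\<dots> = Ev C ?A (Btm C)"
    by (simp add: TenA_Cmp[symmetric, OF X(1) do X(1) do X(1) do X(2) di X(2) di] X(3)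
        TenA_Idn[OF X(1) do] Idn_left[OF do do di] Idn_right[OF Ten_obj[OF X(1) do] Btm_obj e])
  finally show ?thesis
    using assms Idn_left[OF Ten_obj[OF X(1) do] Btm_obj e] e
    by (simp add: ihom_def iobj_iten iobj_idual iobj_ibtm) (simp add: iten_def idual_def ibtm_def)
qed

lemma ihom_Cur:
  assumes f: "f \<in> ihom (iten C X Y) (ibtm C)" and X: "iobj X" and Y: "iobj Y"
  shows "Cur C (fst X) (fst Y) (Btm C) f \<in> ihom Y (idual C X)"
proof -
  let ?A = "fst X" and ?B = "fst Y" and ?s = "snd X" and ?t = "snd Y"
  note X' = iobjD[OF X] and Y' = iobjD[OF Y]
  note i = Idn_hom[OF X'(1)] Idn_hom[OF Y'(1)]
  have fh: "f \<in> Hom C (?A \<otimes> ?B) (Btm C)" and "Idn C (Btm C) \<cdot> f = f \<cdot> (?s \<odot> ?t)"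
    using f by (auto simp: ihom_def) (auto simp: iten_def ibtm_def)
  then have inv: "f = f \<cdot> (?s \<odot> ?t)"
    using Idn_left[OF Ten_obj[OF X'(1) Y'(1)] Btm_obj fh] by simp
  \<comment> \<open>Composing the invariance of \<open>f\<close> with \<open>?s\<close> on the first
    factor cancels \<open>?s\<close> there and leaves \<open>?t\<close> on the second. The two
    naturality laws of \<open>Cur\<close> turn this equation into the commuting square.\<close>
  have "f \<cdot> (?s \<odot> Idn C ?B) = (f \<cdot> (?s \<odot> ?t)) \<cdot> (?s \<odot> Idn C ?B)" by (rule arg_cong[OF inv])
  also have "\<dots> = f \<cdot> ((?s \<odot> ?t) \<cdot> (?s \<odot> Idn C ?B))"
    by (rule Cmp_assoc[OF Ten_obj Ten_obj Ten_obj Btm_obj TenA_hom TenA_hom fh])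
       (fact i X' Y')+
  also have "\<dots> = f \<cdot> (Idn C ?A \<odot> ?t)"
    using TenA_Cmp[OF X'(1) Y'(1) X'(1) Y'(1) X'(1) Y'(1) X'(2) i(2) X'(2) Y'(2)]
      X'(3) Idn_right[OF Y'(1,1,2)] by simp
  finally have "dual_arr C ?A ?A ?s \<cdot> Cur C ?A ?B (Btm C) f = Cur C ?A ?B (Btm C) f \<cdot> ?t"
    using dual_arr_Cur[OF X'(1,1) Y'(1) X'(2) fh] Cur_Cmp[OF X'(1) Y'(1,1,2) fh] by simp
  then show ?thesis
    using Cur_dual_hom[OF X'(1) Y'(1) fh] X Y by (simp add: ihom_def iobj_idual) (simp add: idual_def)
qed

lemma iiso_to_bidual:
  assumes "iobj X"
  shows "to_bidual C (fst X) \<in> iiso X (idual C (idual C X))"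
proof -
  have "Ev C (fst X) (Btm C) \<cdot> Sym C (dual C (fst X)) (fst X) \<in> ihom (iten C (idual C X) X) (ibtm C)"
    using ihom_Cmp[OF ihom_Sym[of "idual C X" X] ihom_Ev[of X]] assms by (simp add: iobj_idual)
  from ihom_Cur[OF this iobj_idual[OF assms] assms]
  show ?thesis using to_bidual_iso[of "fst X"] iobjD[OF assms]
    by (simp add: iiso_def to_bidual_def)
qed

text \<open>This is the arrow that \<open>neg_iso\<close> assigns to \<open>Bottom\<close>. Its
  inverse \<open>?c\<close> is the currying of the left unit at \<open>Btm\<close>.\<close>

lemma iiso_dual_Unt: "Ev C \<one> (Btm C) \<cdot> inv_arr C (\<one> \<otimes> dual C \<one>) (dual C \<one>) (Lun C (dual C \<one>))
    \<in> iiso (idual C (iunt C)) (ibtm C)"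
proof -
  let ?D = "dual C \<one>" and ?e = "Ev C \<one> (Btm C)"
  let ?l = "inv_arr C (\<one> \<otimes> ?D) ?D (Lun C ?D)" and ?c = "Cur C \<one> (Btm C) (Btm C) (Lun C (Btm C))"
  note D = dual_obj[OF Unt_obj] and e = Ev_dual_hom[OF Unt_obj]
  note o = Unt_obj Ten_obj[OF Unt_obj D] D Btm_obj Ten_obj[OF Unt_obj Btm_obj]
  have L: "Lun C ?D \<in> iiso (iten C (iunt C) (idual C (iunt C))) (idual C (iunt C))"
    using iiso_Lun[OF iobj_idual[OF iobj_iunt]] by simp
  have h: "?e \<cdot> ?l \<in> ihom (idual C (iunt C)) (ibtm C)"
    using ihom_Cmp[OF iiso_ihom[OF iiso_inv_arr[OF L]] ihom_Ev[OF iobj_iunt, simplified]] by simp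
  have l: "?l \<in> Hom C ?D (\<one> \<otimes> ?D)" "Lun C ?D \<in> Hom C (\<one> \<otimes> ?D) ?D" "?l \<cdot> Lun C ?D = Idn C (\<one> \<otimes> ?D)"
    using is_inverse_inv_arr[OF o(2,3) Lun_iso[OF D]] by (auto simp: is_inverse_def)
  obtain b where b: "b \<in> Hom C (Btm C) (\<one> \<otimes> Btm C)" "Lun C (Btm C) \<cdot> b = Idn C (Btm C)"
    and L': "Lun C (Btm C) \<in> Hom C (\<one> \<otimes> Btm C) (Btm C)"
    using Lun_iso[OF Btm_obj] by (auto simp: is_iso_def is_inverse_def)
  note c = Cur_dual_hom[OF o(1,4) L']
  have el: "?e \<cdot> ?l \<in> Hom C ?D (Btm C)" using Cmp_hom[OF o(3,2,4) l(1) e] .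
  have ell: "(?e \<cdot> ?l) \<cdot> Lun C ?D = ?e"
    using Cmp_assoc[OF o(2,3,2,4) l(2,1) e] l(3) Idn_right[OF o(2,4) e] by simp
  \<comment> \<open>Naturality of the left unit at \<open>?e \<cdot> ?l\<close> reduces the
    uncurried arrow to \<open>?e\<close>, which is the uncurrying of the identity.\<close>
  have "?c \<cdot> (?e \<cdot> ?l) = Cur C \<one> ?D (Btm C) (?e \<cdot> (Idn C \<one> \<odot> Idn C ?D))"
    using Cur_Cmp[OF o(1,4,3) el L'] Lun_natural[OF o(3,4) el] ell
    by (simp add: TenA_Idn[OF o(1,3)] Idn_right[OF o(2,4) e])
  also have "\<dots> = Idn C ?D"
    using Cur_Ev[OF o(1,3,4), of "Idn C ?D"] Idn_hom[OF D] by (simp add: dual_def)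
  finally have ce: "?c \<cdot> (?e \<cdot> ?l) = Idn C ?D" .
  \<comment> \<open>Naturality of the left unit at \<open>?c\<close>, with both unit isomorphisms
    moved to the other side; \<open>b\<close> is the inverse of the one at
    \<open>Btm\<close>.\<close>
  have lc: "?l \<cdot> ?c = (Idn C \<one> \<odot> ?c) \<cdot> b"
  proof -
    have ic: "Idn C \<one> \<odot> ?c \<in> Hom C (\<one> \<otimes> Btm C) (\<one> \<otimes> ?D)" using TenA_hom o Idn_hom c by blast
    note icb = Cmp_hom[OF o(4,5,2) b(1) ic]
    have "?l \<cdot> ?c = ?l \<cdot> (?c \<cdot> (Lun C (Btm C) \<cdot> b))" using b(2) Idn_right[OF o(4,3) c] by simp
    also have "\<dots> = ?l \<cdot> (Lun C ?D \<cdot> ((Idn C \<one> \<odot> ?c) \<cdot> b))"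
      using Cmp_assoc[OF o(4,5,4,3) b(1) L' c] Lun_natural[OF o(4,3) c]
        Cmp_assoc[OF o(4,5,2,3) b(1) ic l(2)] by simp
    also have "\<dots> = (Idn C \<one> \<odot> ?c) \<cdot> b"
      using Cmp_assoc[OF o(4,2,3,2) icb l(2,1)] l(3) Idn_left[OF o(4,2) icb] by simp
    finally show ?thesis .
  qed
  have "(?e \<cdot> ?l) \<cdot> ?c = (?e \<cdot> (Idn C \<one> \<odot> ?c)) \<cdot> b"
    using Cmp_assoc[OF o(4,3,2,4) c l(1) e] lc
      Cmp_assoc[OF o(4,5,2,4) b(1) TenA_hom[OF o(1,4,1,3) Idn_hom[OF o(1)] c] e] by simp
  also have "\<dots> = Idn C (Btm C)" using Ev_Cur[OF o(1,4,4) L'] b by simp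
  finally have "is_inverse C ?D (Btm C) (?e \<cdot> ?l) ?c"
    using ce el c by (simp add: is_inverse_def)
  then show ?thesis using h by (auto simp: iiso_def is_iso_def)
qed

text \<open>The name of the right unit of \<open>Btm\<close> is compared with \<open>to_bidual \<one>\<close> along an isomorphism
  \<open>dual \<one> \<rightarrow> Btm\<close> that is tailored to this purpose, so that no coherence law is needed.\<close>

lemma iiso_Unt_dual_Btm: "Cur C (Btm C) \<one> (Btm C) (Run C (Btm C)) \<in> iiso (iunt C) (idual C (ibtm C))"
proof -
  let ?D = "dual C \<one>" and ?B = "Btm C" and ?c = "Cur C (Btm C) \<one> (Btm C) (Run C (Btm C))"
  let ?q = "Ev C \<one> ?B \<cdot> Sym C ?D \<one>" and ?r = "inv_arr C (?D \<otimes> \<one>) ?D (Run C ?D)"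
  note o = Unt_obj Btm_obj dual_obj[OF Unt_obj]
  note t = Ten_obj[OF o(1,3)] Ten_obj[OF o(3,1)] Ten_obj[OF o(2,1)]
  have R: "Run C ?B \<in> iiso (iten C (ibtm C) (iunt C)) (ibtm C)"
    using iiso_Run[OF iobj_ibtm] by simp
  note c = ihom_Cur[OF iiso_ihom[OF R] iobj_ibtm iobj_iunt, simplified]
  have RB: "Run C ?B \<in> Hom C (?B \<otimes> \<one>) ?B" using ihomD(5)[OF iiso_ihom[OF R]] by simp
  have Rinv: "is_inverse C (?D \<otimes> \<one>) ?D (Run C ?D) ?r"
    using is_inverse_inv_arr[OF t(2) o(3) Run_iso[OF o(3)]] .
  have r: "?r \<in> Hom C ?D (?D \<otimes> \<one>)" "Run C ?D \<in> Hom C (?D \<otimes> \<one>) ?D" "?r \<cdot> Run C ?D = Idn C (?D \<otimes> \<one>)"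
    using Rinv by (auto simp: is_inverse_def)
  have r_iso: "is_iso C ?D (?D \<otimes> \<one>) ?r" using Rinv by (auto simp: is_iso_def is_inverse_def)
  have S_iso: "is_iso C (?D \<otimes> \<one>) (\<one> \<otimes> ?D) (Sym C ?D \<one>)"
    unfolding is_iso_def is_inverse_def using Sym_hom Sym_Sym o by blast
  have E_iso: "is_iso C (\<one> \<otimes> ?D) ?B (Ev C \<one> ?B)"
  proof -
    let ?l = "inv_arr C (\<one> \<otimes> ?D) ?D (Lun C ?D)"
    have l: "?l \<in> Hom C ?D (\<one> \<otimes> ?D)" "Lun C ?D \<in> Hom C (\<one> \<otimes> ?D) ?D" "?l \<cdot> Lun C ?D = Idn C (\<one> \<otimes> ?D)"
      using is_inverse_inv_arr[OF t(1) o(3) Lun_iso[OF o(3)]] by (auto simp: is_inverse_def)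
    have "is_iso C ?D ?B (Ev C \<one> ?B \<cdot> ?l)" using iiso_dual_Unt by (simp add: iiso_def)
    from is_iso_Cmp[OF t(1) o(3,2) Lun_iso[OF o(3)] this] show ?thesis
      using Cmp_assoc[OF t(1) o(3) t(1) o(2) l(2,1) Ev_dual_hom[OF o(1)]] l(3)
        Idn_right[OF t(1) o(2) Ev_dual_hom[OF o(1)]] by simp
  qed
  have q_iso: "is_iso C (?D \<otimes> \<one>) ?B ?q" using is_iso_Cmp[OF t(2,1) o(2) S_iso E_iso] .
  then have q: "?q \<in> Hom C (?D \<otimes> \<one>) ?B" by (auto simp: is_iso_def is_inverse_def)
  \<comment> \<open>The factor \<open>?r\<close> makes \<open>?a \<cdot> Run C ?D\<close> equal to
    \<open>?q\<close>. By naturality of the right unit this is also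
    \<open>Run C ?B \<cdot> (?a \<odot> Idn C \<one>)\<close>, and \<open>?q\<close> curries to
    \<open>to_bidual C \<one>\<close>.\<close>
  let ?a = "?q \<cdot> ?r"
  have a_iso: "is_iso C ?D ?B ?a" using is_iso_Cmp[OF o(3) t(2) o(2) r_iso q_iso] .
  then have a: "?a \<in> Hom C ?D ?B" by (auto simp: is_iso_def is_inverse_def)
  have "Run C ?B \<cdot> (?a \<odot> Idn C \<one>) = ?q"
    using Run_natural[OF o(3,2) a] Cmp_assoc[OF t(2) o(3) t(2) o(2) r(2,1) q] r(3)
      Idn_right[OF t(2) o(2) q] by simp
  then have dc: "dual_arr C ?D ?B ?a \<cdot> ?c = to_bidual C \<one>"
    using dual_arr_Cur[OF o(3,2,1) a RB] by (simp add: to_bidual_def)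
  \<comment> \<open>With identity involutions equivariance says nothing; only the invertibility of
    the dual arrow is extracted.\<close>
  have "?a \<in> iiso (?D, Idn C ?D) (ibtm C)"
    using a_iso a o Idn_left[OF o(3,2) a] Idn_right[OF o(3,2) a]
    by (simp add: iiso_def ihom_def iobj_Idn iobj_ibtm) (simp add: ibtm_def)
  from iiso_dual_arr[OF this]
  have d_iso: "is_iso C (dual C ?B) (dual C ?D) (dual_arr C ?D ?B ?a)" by (simp add: iiso_def)
  let ?d = "dual_arr C ?D ?B ?a"
  note dd = dual_obj[OF o(2)] dual_obj[OF o(3)]
  obtain d' where d': "d' \<in> Hom C (dual C ?D) (dual C ?B)" "d' \<cdot> ?d = Idn C (dual C ?B)"
    "is_iso C (dual C ?D) (dual C ?B) d'" and d: "?d \<in> Hom C (dual C ?B) (dual C ?D)"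
    using d_iso unfolding is_iso_def is_inverse_def by blast
  have ch: "?c \<in> Hom C \<one> (dual C ?B)" using Cur_dual_hom[OF o(2,1) RB] .
  have "d' \<cdot> to_bidual C \<one> = ?c"
    using Cmp_assoc[OF o(1) dd(1,2,1) ch d d'(1)] d'(2) dc Idn_left[OF o(1) dd(1) ch] by simp
  then have "is_iso C \<one> (dual C ?B) ?c"
    using is_iso_Cmp[OF o(1) dd(2,1) to_bidual_iso[OF o(1)] d'(3)] by simp
  then show ?thesis using c by (simp add: iiso_def)
qed

end


section \<open>Exponentials\<close>

definition iL :: "('o, 'a, 'p, 'b) llm \<Rightarrow> 'p \<times> 'b \<Rightarrow> 'o \<times> 'a" where
  "iL M X = (LO M (fst X), LA M (snd X))"

definition iM :: "('o, 'a, 'p, 'b) llm \<Rightarrow> 'o \<times> 'a \<Rightarrow> 'p \<times> 'b" where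
  "iM M X = (MO M (fst X), MA M (snd X))"

definition ibang :: "('o, 'a, 'p, 'b) llm \<Rightarrow> 'o \<times> 'a \<Rightarrow> 'o \<times> 'a" where
  "ibang M X = (bang M (fst X), bang_arr M (snd X))"

lemma fst_iL [simp]: "fst (iL M X) = LO M (fst X)"
  and fst_iM [simp]: "fst (iM M Y) = MO M (fst Y)"
  and fst_ibang [simp]: "fst (ibang M Y) = bang M (fst Y)"
  by (simp_all add: iL_def iM_def ibang_def)

lemma ibang_eq: "ibang M X = iL M (iM M X)"
  by (simp add: ibang_def iL_def iM_def bang_def bang_arr_def)

section \<open>Equivariance of the product structure\<close>

context cartesian
begin

lemma to_unit_unique: "\<lbrakk>A \<in> Obj C; f \<in> Hom C A \<one>; g \<in> Hom C A \<one>\<rbrakk> \<Longrightarrow> f = g"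
  using Unt_terminal unfolding is_terminal_def by blast

lemma to_unit_hom: "A \<in> Obj C \<Longrightarrow> to_unit C A \<in> Hom C A \<one>"
  using theI'[of "\<lambda>f. f \<in> Hom C A \<one>"] Unt_terminal unfolding is_terminal_def to_unit_def by simp

lemma ihom_to_unit:
  assumes "iobj X"
  shows "to_unit C (fst X) \<in> ihom X (iunt C)"
proof -
  note X = iobjD[OF assms] and u = to_unit_hom[OF iobjD(1)[OF assms]]
  have "Idn C \<one> \<cdot> to_unit C (fst X) = to_unit C (fst X) \<cdot> snd X"
    using to_unit_unique[OF X(1) Cmp_hom[OF X(1) Unt_obj Unt_obj u Idn_hom[OF Unt_obj]]
        Cmp_hom[OF X(1,1) Unt_obj X(2) u]] .
  then show ?thesis using u assms iobj_iunt by (simp add: ihom_def) (simp add: iunt_def)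
qed

lemma ihom_proj1:
  assumes "iobj X" "iobj Y"
  shows "proj1 C (fst X) (fst Y) \<in> ihom (iten C X Y) X"
  unfolding proj1_def
  using ihom_Cmp[OF ihom_TenA[OF ihom_Idn[OF assms(1)] ihom_to_unit[OF assms(2)]]
      iiso_ihom[OF iiso_Run[OF assms(1)]]] .

lemma ihom_proj2:
  assumes "iobj X" "iobj Y"
  shows "proj2 C (fst X) (fst Y) \<in> ihom (iten C X Y) Y"
  unfolding proj2_def
  using ihom_Cmp[OF ihom_TenA[OF ihom_to_unit[OF assms(1)] ihom_Idn[OF assms(2)]]
      iiso_ihom[OF iiso_Lun[OF assms(2)]]] .

lemma product_hom_eqI:
  assumes "A \<in> Obj C" "B \<in> Obj C" "X \<in> Obj C" "f \<in> Hom C X (A \<otimes> B)" "g \<in> Hom C X (A \<otimes> B)"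
    and "proj1 C A B \<cdot> f = proj1 C A B \<cdot> g" "proj2 C A B \<cdot> f = proj2 C A B \<cdot> g"
  shows "f = g"
proof -
  have p: "proj1 C A B \<in> Hom C (A \<otimes> B) A" "proj2 C A B \<in> Hom C (A \<otimes> B) B"
    and u: "\<And>h k. \<lbrakk>h \<in> Hom C X A; k \<in> Hom C X B\<rbrakk> \<Longrightarrow>
      \<exists>!u. u \<in> Hom C X (A \<otimes> B) \<and> proj1 C A B \<cdot> u = h \<and> proj2 C A B \<cdot> u = k"
    using Ten_product[OF assms(1,2)] assms(3) unfolding is_product_def by auto
  have "proj1 C A B \<cdot> g \<in> Hom C X A" "proj2 C A B \<cdot> g \<in> Hom C X B"
    using Cmp_hom[OF assms(3) Ten_obj[OF assms(1,2)] assms(1,5) p(1)]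
      Cmp_hom[OF assms(3) Ten_obj[OF assms(1,2)] assms(2,5) p(2)] by auto
  from u[OF this] show ?thesis using assms by blast
qed

lemma diagonal_props:
  assumes "A \<in> Obj C"
  shows "diagonal C A \<in> Hom C A (A \<otimes> A)" "proj1 C A A \<cdot> diagonal C A = Idn C A"
    "proj2 C A A \<cdot> diagonal C A = Idn C A"
proof -
  have "\<exists>!h. h \<in> Hom C A (A \<otimes> A) \<and> proj1 C A A \<cdot> h = Idn C A \<and> proj2 C A A \<cdot> h = Idn C A"
    using Ten_product[OF assms assms] Idn_hom[OF assms] assms unfolding is_product_def by blast
  from theI'[OF this] show "diagonal C A \<in> Hom C A (A \<otimes> A)"
    "proj1 C A A \<cdot> diagonal C A = Idn C A" "proj2 C A A \<cdot> diagonal C A = Idn C A"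
    unfolding diagonal_def by auto
qed

text \<open>Both sides are compared after each projection. A projection is equivariant and splits
  the diagonal, so either composite reduces to the involution itself.\<close>

lemma ihom_diagonal:
  assumes "iobj X"
  shows "diagonal C (fst X) \<in> ihom X (iten C X X)"
proof -
  let ?A = "fst X" and ?s = "snd X" and ?d = "diagonal C (fst X)"
  note X = iobjD[OF assms] and d = diagonal_props[OF iobjD(1)[OF assms]]
  note AA = Ten_obj[OF X(1,1)] and ss = TenA_hom[OF X(1,1,1,1,2,2)]
  have proj: "p \<cdot> ((?s \<odot> ?s) \<cdot> ?d) = p \<cdot> (?d \<cdot> ?s)"
    if p: "p \<in> ihom (iten C X X) X" and pd: "p \<cdot> ?d = Idn C ?A" for p
  proof -
    have p': "p \<in> Hom C (?A \<otimes> ?A) ?A" "?s \<cdot> p = p \<cdot> (?s \<odot> ?s)"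
      using p by (auto simp: ihom_def) (simp add: iten_def)
    have "p \<cdot> ((?s \<odot> ?s) \<cdot> ?d) = ?s \<cdot> (p \<cdot> ?d)"
      using Cmp_assoc[OF X(1) AA AA X(1) d(1) ss p'(1)] p'(2)
        Cmp_assoc[OF X(1) AA X(1,1) d(1) p'(1) X(2)] by simp
    also have "\<dots> = p \<cdot> (?d \<cdot> ?s)"
      using Cmp_assoc[OF X(1,1) AA X(1) X(2) d(1) p'(1)] pd Idn_left[OF X(1,1,2)]
        Idn_right[OF X(1,1,2)] by simp
    finally show ?thesis .
  qed
  have "(?s \<odot> ?s) \<cdot> ?d = ?d \<cdot> ?s"
    using product_hom_eqI[OF X(1,1,1) Cmp_hom[OF X(1) AA AA d(1) ss] Cmp_hom[OF X(1,1) AA X(2) d(1)]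
        proj[OF ihom_proj1[OF assms assms] d(2)] proj[OF ihom_proj2[OF assms assms] d(3)]] .
  then show ?thesis
    using d(1) assms by (simp add: ihom_def iobj_iten) (simp add: iten_def)
qed

end

section \<open>The exponential and its comonoid structure\<close>

context ll_model
begin

lemma iobj_iL: "K.iobj X \<Longrightarrow> iobj (iL M X)"
  using L.FA_Cmp[of "fst X" "fst X" "fst X" "snd X" "snd X"]
  by (simp add: iobj_def K.iobj_def iL_def L.FO_obj L.FA_hom L.FA_Idn)

lemma iobj_iM: "iobj X \<Longrightarrow> K.iobj (iM M X)"
  using R.FA_Cmp[of "fst X" "fst X" "fst X" "snd X" "snd X"]
  by (simp add: iobj_def K.iobj_def iM_def R.FO_obj R.FA_hom R.FA_Idn)

lemma iobj_ibang: "iobj X \<Longrightarrow> iobj (ibang M X)"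
  by (simp add: ibang_eq iobj_iL iobj_iM)

lemma ihom_LA:
  assumes "u \<in> K.ihom X Y"
  shows "LA M u \<in> ihom (iL M X) (iL M Y)"
proof -
  note u = K.ihomD[OF assms]
  have "LA M (snd Y) \<cdot> LA M u = LA M u \<cdot> LA M (snd X)"
    using L.FA_Cmp[OF u(3,4,4,5,7)] L.FA_Cmp[OF u(3,3,4,6,5)] u(8) by simp
  then show ?thesis using u L.FA_hom[OF u(3,4,5)]
    by (simp add: ihom_def iobj_iL) (simp add: iL_def)
qed

lemma ihom_MA:
  assumes "u \<in> ihom X Y"
  shows "MA M u \<in> K.ihom (iM M X) (iM M Y)"
proof -
  note u = ihomD[OF assms]
  have "MA M (snd Y) \<cdot>\<^bsub>Crt M\<^esub> MA M u = MA M u \<cdot>\<^bsub>Crt M\<^esub> MA M (snd X)"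
    using R.FA_Cmp[OF u(3,4,4,5,7)] R.FA_Cmp[OF u(3,3,4,6,5)] u(8) by simp
  then show ?thesis using u R.FA_hom[OF u(3,4,5)]
    by (simp add: K.ihom_def iobj_iM) (simp add: iM_def)
qed

lemma ihom_bang_arr: "f \<in> ihom X Y \<Longrightarrow> bang_arr M f \<in> ihom (ibang M X) (ibang M Y)"
  unfolding ibang_eq bang_arr_def by (intro ihom_LA ihom_MA)

lemma iiso_bang_arr:
  assumes "f \<in> iiso X Y"
  shows "bang_arr M f \<in> iiso (ibang M X) (ibang M Y)"
proof -
  obtain g where f: "f \<in> ihom X Y" and fg: "f \<in> Hom M (fst X) (fst Y)" "g \<in> Hom M (fst Y) (fst X)"
    "g \<cdot> f = Idn M (fst X)" "f \<cdot> g = Idn M (fst Y)"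
    using assms unfolding iiso_def is_iso_def is_inverse_def by auto
  note o = ihomD(3,4)[OF f]
  have h: "bang_arr M f \<in> Hom M (bang M (fst X)) (bang M (fst Y))"
    "bang_arr M g \<in> Hom M (bang M (fst Y)) (bang M (fst X))"
    using o fg unfolding bang_arr_def bang_def by (auto intro!: L.FA_hom R.FA_hom R.FO_obj)
  have "bang_arr M g \<cdot> bang_arr M f = Idn M (bang M (fst X))"
    using o
    by (simp add: L.FA_Cmp[symmetric, OF _ _ _ R.FA_hom[OF o fg(1)] R.FA_hom[OF o(2,1) fg(2)]]
        R.FA_Cmp[symmetric, OF o o(1) fg(1,2)] fg(3) bang_arr_def bang_def R.FO_obj R.FA_Idn L.FA_Idn)
  moreover have "bang_arr M f \<cdot> bang_arr M g = Idn M (bang M (fst Y))"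
    using o
    by (simp add: L.FA_Cmp[symmetric, OF _ _ _ R.FA_hom[OF o(2,1) fg(2)] R.FA_hom[OF o fg(1)]]
        R.FA_Cmp[symmetric, OF o(2) o fg(2,1)] fg(4) bang_arr_def bang_def R.FO_obj R.FA_Idn L.FA_Idn)
  ultimately have "is_iso M (bang M (fst X)) (bang M (fst Y)) (bang_arr M f)"
    using h unfolding is_iso_def is_inverse_def by blast
  then show ?thesis using ihom_bang_arr[OF f] by (simp add: iiso_def)
qed

text \<open>As usual for a monoidal adjunction, the left adjoint is strong monoidal: the inverse of its
  structure map is the transpose of the structure map of the right adjoint along the unit.\<close>

lemma LM_iso:
  assumes X: "X \<in> Obj (Crt M)" and Y: "Y \<in> Obj (Crt M)"
  shows "is_iso M (LO M X \<otimes> LO M Y) (LO M (X \<otimes>\<^bsub>Crt M\<^esub> Y)) (LM M X Y)"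
proof -
  let ?K = "Crt M" and ?A = "LO M X" and ?B = "LO M Y"
  let ?P = "X \<otimes>\<^bsub>?K\<^esub> Y" and ?T = "LO M X \<otimes> LO M Y" and ?H = "Eta M X \<odot>\<^bsub>?K\<^esub> Eta M Y"
  let ?Q = "MO M ?A \<otimes>\<^bsub>?K\<^esub> MO M ?B"
  let ?a = "MM M ?A ?B \<cdot>\<^bsub>?K\<^esub> ?H" and ?m = "LM M X Y"
  note o = L.FO_obj[OF X] L.FO_obj[OF Y]
  note mo = R.FO_obj[OF o(1)] R.FO_obj[OF o(2)]
  note P = K.Ten_obj[OF X Y] and T = Ten_obj[OF o] and Q = K.Ten_obj[OF mo]
  note LP = L.FO_obj[OF P] and MT = R.FO_obj[OF T] and LQ = L.FO_obj[OF Q]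
  note LMT = L.FO_obj[OF MT]
  note H = K.TenA_hom[OF X Y mo Eta_hom[OF X] Eta_hom[OF Y]] and mm = R.\<mu>_hom[OF o]
  note a = K.Cmp_hom[OF P Q MT H mm]
  note La = L.FA_hom[OF P MT a] and eps = Eps_hom[OF T] and m = L.\<mu>_hom[OF X Y]
  note Mm = R.FA_hom[OF T LP m]
  let ?g = "Eps M ?T \<cdot> LA M ?a"
  have g: "?g \<in> Hom M (LO M ?P) ?T" using Cmp_hom[OF LP LMT T La eps] .
  \<comment> \<open>One composite: naturality of the counit brings \<open>Eps\<close> to the front,
    \<open>Eta_monoidal\<close> collapses the rest to the image of a unit, and a triangle identity
    finishes.\<close>
  have "?m \<cdot> ?g = (?m \<cdot> Eps M ?T) \<cdot> LA M ?a" using Cmp_assoc[OF LP LMT T LP La eps m] by simp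
  also have "\<dots> = Eps M (LO M ?P) \<cdot> (LA M (MA M ?m) \<cdot> LA M ?a)"
    using Eps_natural[OF T LP m]
      Cmp_assoc[OF LP LMT L.FO_obj[OF R.FO_obj[OF LP]] LP La L.FA_hom[OF MT R.FO_obj[OF LP] Mm]
        Eps_hom[OF LP]] by simp
  also have "\<dots> = Eps M (LO M ?P) \<cdot> LA M (MA M ?m \<cdot>\<^bsub>?K\<^esub> ?a)"
    using L.FA_Cmp[OF P MT R.FO_obj[OF LP] a Mm] by simp
  also have "MA M ?m \<cdot>\<^bsub>?K\<^esub> ?a = Eta M ?P"
    using Eta_monoidal[OF X Y] K.Cmp_assoc[OF P Q MT R.FO_obj[OF LP] H mm Mm] by simp
  finally have mg: "?m \<cdot> ?g = Idn M (LO M ?P)" using triangle_L[OF P] by simp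
  note LE = L.FA_hom[OF X mo(1) Eta_hom[OF X]] L.FA_hom[OF Y mo(2) Eta_hom[OF Y]]
  note lo = L.FO_obj[OF mo(1)] L.FO_obj[OF mo(2)]
  note LE' = TenA_hom[OF o lo LE] and LH = L.FA_hom[OF P Q H] and Lmm = L.FA_hom[OF Q MT mm]
    and m' = L.\<mu>_hom[OF mo] and LT = Ten_obj[OF lo]
  \<comment> \<open>The other composite: naturality of \<open>LM\<close> at the two units, followed
    by \<open>Eps_monoidal\<close>, leaves one triangle identity per factor.\<close>
  have "LA M ?a \<cdot> ?m = LA M (MM M ?A ?B) \<cdot> (LA M ?H \<cdot> ?m)"
    using L.FA_Cmp[OF P Q MT H mm] Cmp_assoc[OF T LP LQ LMT m LH Lmm] by simp
  also have "\<dots> = LA M (MM M ?A ?B) \<cdot> (LM M (MO M ?A) (MO M ?B) \<cdot> (LA M (Eta M X) \<odot> LA M (Eta M Y)))"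
    using L.\<mu>_natural[OF X Y mo Eta_hom[OF X] Eta_hom[OF Y]] by simp
  also have "\<dots> = LA M (MM M ?A ?B) \<cdot> LM M (MO M ?A) (MO M ?B) \<cdot> (LA M (Eta M X) \<odot> LA M (Eta M Y))"
    using Cmp_assoc[OF T LT LQ LMT LE' m' Lmm] by simp
  finally have "?g \<cdot> ?m = Eps M ?T \<cdot> (LA M (MM M ?A ?B) \<cdot> LM M (MO M ?A) (MO M ?B)
      \<cdot> (LA M (Eta M X) \<odot> LA M (Eta M Y)))"
    using Cmp_assoc[OF T LP LMT T m La eps] by simp
  also have "\<dots> = (Eps M ?T \<cdot> LA M (MM M ?A ?B) \<cdot> LM M (MO M ?A) (MO M ?B))
      \<cdot> (LA M (Eta M X) \<odot> LA M (Eta M Y))"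
    using Cmp_assoc[OF T LT LMT T LE' Cmp_hom[OF LT LQ LMT m' Lmm] eps]
      Cmp_assoc[OF LT LQ LMT T m' Lmm eps] by simp
  also have "\<dots> = Idn M ?T"
    using Eps_monoidal[OF o] TenA_Cmp[OF o lo o LE Eps_hom[OF o(1)] Eps_hom[OF o(2)]]
      triangle_L[OF X] triangle_L[OF Y] TenA_Idn[OF o] by simp
  finally show ?thesis using mg g m unfolding is_iso_def is_inverse_def by blast
qed

text \<open>The nullary case of the same transposition. One composite is
  \<open>Eps_monoidal_unit\<close> as it stands; the other uses \<open>Eta_monoidal_unit\<close> and
  a triangle identity.\<close>

lemma LM0_iso: "is_iso M \<one> (LO M \<one>\<^bsub>Crt M\<^esub>) (LM0 M)"
proof -
  let ?I = "\<one>\<^bsub>Crt M\<^esub>" and ?g = "Eps M \<one> \<cdot> LA M (MM0 M)"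
  note I = K.Unt_obj and U = Unt_obj
  note MU = R.FO_obj[OF U] and LI = L.FO_obj[OF I]
  note LMU = L.FO_obj[OF MU]
  note m = L.\<mu>0_hom and n = R.\<mu>0_hom and eps = Eps_hom[OF U]
  note Ln = L.FA_hom[OF I MU n] and Mm = R.FA_hom[OF U LI m]
  have g: "?g \<in> Hom M (LO M ?I) \<one>" using Cmp_hom[OF LI LMU U Ln eps] .
  have "LM0 M \<cdot> ?g = (LM0 M \<cdot> Eps M \<one>) \<cdot> LA M (MM0 M)" using Cmp_assoc[OF LI LMU U LI Ln eps m] by simp
  also have "\<dots> = Eps M (LO M ?I) \<cdot> (LA M (MA M (LM0 M)) \<cdot> LA M (MM0 M))"
    using Eps_natural[OF U LI m]
      Cmp_assoc[OF LI LMU L.FO_obj[OF R.FO_obj[OF LI]] LI Ln L.FA_hom[OF MU R.FO_obj[OF LI] Mm]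
        Eps_hom[OF LI]] by simp
  also have "\<dots> = Idn M (LO M ?I)"
    using L.FA_Cmp[OF I MU R.FO_obj[OF LI] n Mm] Eta_monoidal_unit triangle_L[OF I] by simp
  finally show ?thesis
    using g m Eps_monoidal_unit unfolding is_iso_def is_inverse_def by blast
qed

text \<open>Invertibility matters here because \<open>contraction\<close> is built from the inverse
  of this arrow.\<close>

lemma iiso_LM:
  assumes "K.iobj X" "K.iobj Y"
  shows "LM M (fst X) (fst Y) \<in> iiso (iten M (iL M X) (iL M Y)) (iL M (iten (Crt M) X Y))"
proof -
  note X = K.iobjD[OF assms(1)] and Y = K.iobjD[OF assms(2)]
  show ?thesis
    using assms L.\<mu>_natural[OF X(1) Y(1) X(1) Y(1) X(2) Y(2)] LM_iso[OF X(1) Y(1)] L.\<mu>_hom[OF X(1) Y(1)]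
    by (simp add: iiso_def ihom_def iobj_iL iobj_iten K.iobj_iten) (simp add: iL_def iten_def)
qed

lemma iiso_LM0: "LM0 M \<in> iiso (iunt M) (iL M (iunt (Crt M)))"
proof -
  note m = L.\<mu>0_hom and LI = L.FO_obj[OF K.Unt_obj]
  show ?thesis
    using LM0_iso m Idn_left[OF Unt_obj LI m] Idn_right[OF Unt_obj LI m]
    by (simp add: iiso_def ihom_def iobj_iunt iobj_iL K.iobj_iunt)
       (simp add: iL_def iunt_def L.FA_Idn K.Unt_obj)
qed

lemma ihom_MM:
  assumes "iobj X" "iobj Y"
  shows "MM M (fst X) (fst Y) \<in> K.ihom (iten (Crt M) (iM M X) (iM M Y)) (iM M (iten M X Y))"
proof -
  note X = iobjD[OF assms(1)] and Y = iobjD[OF assms(2)]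
  show ?thesis
    using assms R.\<mu>_natural[OF X(1) Y(1) X(1) Y(1) X(2) Y(2)] R.\<mu>_hom[OF X(1) Y(1)]
    by (simp add: K.ihom_def iobj_iM iobj_iten K.iobj_iten) (simp add: iM_def iten_def)
qed

lemma ihom_MM0: "MM0 M \<in> K.ihom (iunt (Crt M)) (iM M (iunt M))"
proof -
  note m = R.\<mu>0_hom and MI = R.FO_obj[OF Unt_obj]
  show ?thesis
    using m K.Idn_left[OF K.Unt_obj MI m] K.Idn_right[OF K.Unt_obj MI m]
    by (simp add: K.ihom_def iobj_iunt iobj_iM K.iobj_iunt)
       (simp add: iM_def iunt_def R.FA_Idn Unt_obj)
qed

lemma ihom_dereliction:
  assumes "iobj X"
  shows "dereliction M (fst X) \<in> ihom (ibang M X) X"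
proof -
  note X = iobjD[OF assms]
  show ?thesis
    using assms Eps_natural[OF X(1,1,2)] Eps_hom[OF X(1)]
    by (simp add: ihom_def iobj_ibang dereliction_def)
       (simp add: ibang_def bang_def bang_arr_def)
qed

lemma ihom_digging:
  assumes "iobj X"
  shows "digging M (fst X) \<in> ihom (ibang M X) (ibang M (ibang M X))"
proof -
  note X = K.iobjD[OF iobj_iM[OF assms]]
  have "Eta M (fst (iM M X)) \<in> K.ihom (iM M X) (iM M (iL M (iM M X)))"
    using assms Eta_natural[OF X(1,1,2)] Eta_hom[OF X(1)]
    by (simp add: K.ihom_def iobj_iM iobj_iL) (simp add: iM_def iL_def)
  from ihom_LA[OF this] show ?thesis by (simp add: digging_def ibang_eq)
qed

lemma ihom_bang_mon:
  assumes "iobj X" "iobj Y"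
  shows "bang_mon M (fst X) (fst Y) \<in> ihom (iten M (ibang M X) (ibang M Y)) (ibang M (iten M X Y))"
  using ihom_Cmp[OF iiso_ihom[OF iiso_LM[OF iobj_iM[OF assms(1)] iobj_iM[OF assms(2)]]]
      ihom_LA[OF ihom_MM[OF assms]]]
  by (simp add: bang_mon_def ibang_eq)

lemma ihom_bang_mon0: "bang_mon0 M \<in> ihom (iunt M) (ibang M (iunt M))"
  using ihom_Cmp[OF iiso_ihom[OF iiso_LM0] ihom_LA[OF ihom_MM0]]
  by (simp add: bang_mon0_def ibang_eq)

lemma ihom_contraction:
  assumes "iobj X"
  shows "contraction M (fst X) \<in> ihom (ibang M X) (iten M (ibang M X) (ibang M X))"
proof -
  note X = iobj_iM[OF assms]
  show ?thesis
    using ihom_Cmp[OF ihom_LA[OF K.ihom_diagonal[OF X]] iiso_ihom[OF iiso_inv_arr[OF iiso_LM[OF X X]]]]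
    by (simp add: contraction_def ibang_eq bang_def)
qed

lemma ihom_weakening:
  assumes "iobj X"
  shows "weakening M (fst X) \<in> ihom (ibang M X) (iunt M)"
  using ihom_Cmp[OF ihom_LA[OF K.ihom_to_unit[OF iobj_iM[OF assms]]]
      iiso_ihom[OF iiso_inv_arr[OF iiso_LM0]]]
  by (simp add: weakening_def ibang_eq)

lemma ihom_copair:
  assumes "h \<in> ihom X Z"
  shows "copair M (fst Z) h \<in> ihom (iten M (idual M Z) X) (ibtm M)"
proof -
  note Z = ihomD(2)[OF assms]
  note dZ = iobj_idual[OF Z]
  show ?thesis
    using ihom_Cmp[OF ihom_TenA[OF ihom_Idn[OF dZ] assms] ihom_Cmp[OF ihom_Sym[OF dZ Z] ihom_Ev[OF Z]]]
    by (simp add: copair_def)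
qed

end


section \<open>Interpretation of formulas and proofs\<close>

text \<open>\<open>iform M W A j\<close> is the interpretation of \<open>plus_form A\<close> in \<open>Inv M\<close>, of which only the
  \<open>j\<close>-th involution is kept.\<close>

definition iform ::
  "('o, 'a, 'p, 'b) llm \<Rightarrow> (nat \<Rightarrow> 'o \<times> (int \<Rightarrow> 'a)) \<Rightarrow> form \<Rightarrow> int \<Rightarrow> 'o \<times> 'a" where
  "iform M W A j = map_prod id (\<lambda>s. s j) (fint (inv_alg M) W (plus_form A))"

text \<open>The \<open>j - 1\<close> under the exponentials is the paragraph that
  \<open>plus_form\<close> inserts there.\<close>

lemma iform_simps [simp]:
  "iform M W (Var x) j = (fst (W x), snd (W x) j)"
  "iform M W (NVar x) j = idual M (fst (W x), snd (W x) j)"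
  "iform M W One j = iunt M"
  "iform M W Bottom j = ibtm M"
  "iform M W (Tensor A B) j = iten M (iform M W A j) (iform M W B j)"
  "iform M W (Parr A B) j = idual M (iten M (idual M (iform M W A j)) (idual M (iform M W B j)))"
  "iform M W (OfCourse A) j = ibang M (iform M W A (j - 1))"
  "iform M W (WhyNot A) j = idual M (ibang M (idual M (iform M W A (j - 1))))"
  "iform M W (Para A) j = iform M W A (j - 1)"
  by (simp_all add: iform_def inv_alg_def idual_def iunt_def ibtm_def iten_def ibang_def
      map_prod_def split: prod.split)

text \<open>Paragraphs leave underlying objects alone, so arrows built from the original formulas
  have the right types for \<open>plus_form A\<close>.\<close>

lemma fst_iform: "fst (iform M W A j) = fint (lin_alg M) (\<lambda>x. fst (W x)) A"
  by (simp add: iform_def fst_fint_inv_alg fint_lin_alg_plus_form)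

text \<open>Formulas are negated as in \<open>lobj\<close>. \<open>Flat A\<close> stays at
  \<open>j\<close> without a shift: the shift of \<open>WhyNot\<close> takes place at the why not
  link, whose flat premises are already read one place lower.\<close>

primrec ilab ::
  "('o, 'a, 'p, 'b) llm \<Rightarrow> (nat \<Rightarrow> 'o \<times> (int \<Rightarrow> 'a)) \<Rightarrow> label \<Rightarrow> int \<Rightarrow> 'o \<times> 'a" where
  "ilab M W (Plain A) j = iform M W (neg A) j"
| "ilab M W (Flat A) j = ibang M (iform M W (neg A) j)"

text \<open>Each entry has its own index because the edges of one sequent may be indexed
  differently.\<close>

primrec ictx ::
  "('o, 'a, 'p, 'b) llm \<Rightarrow> (nat \<Rightarrow> 'o \<times> (int \<Rightarrow> 'a)) \<Rightarrow> (label \<times> int) list \<Rightarrow> 'o \<times> 'a" where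
  "ictx M W [] = iunt M"
| "ictx M W (x # xs) = iten M (ilab M W (fst x) (snd x)) (ictx M W xs)"

lemma fst_ilab: "fst (ilab M W l j) = lobj M (\<lambda>x. fst (W x)) l"
  by (cases l) (simp_all add: fst_iform)

lemma fst_ictx: "fst (ictx M W xs) = ctx M (\<lambda>x. fst (W x)) (map fst xs)"
  by (induction xs) (simp_all add: fst_ilab)

section \<open>Equivariance of negation, of the context maps and of the proof rules\<close>

locale inv_valuation = ll_model M
  for M :: "('o, 'a, 'p, 'b) llm" (structure) +
  fixes W :: "nat \<Rightarrow> 'o \<times> (int \<Rightarrow> 'a)"
  assumes W_obj: "W x \<in> Inv_obj M"
begin

abbreviation "v \<equiv> \<lambda>x. fst (W x)"

lemma iobj_W: "iobj (fst (W x), snd (W x) j)"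
  using W_obj[of x] by (auto simp: Inv_obj_def iobj_def split_beta)

lemma iobj_iform: "iobj (iform M W A j)"
  by (induction A arbitrary: j)
     (simp_all add: iobj_W iobj_idual iobj_iunt iobj_ibtm iobj_iten iobj_ibang)

lemma iobj_ilab: "iobj (ilab M W l j)"
  by (cases l) (simp_all add: iobj_iform iobj_ibang)

lemma iobj_ictx: "iobj (ictx M W xs)"
  by (induction xs) (simp_all add: iobj_iunt iobj_iten iobj_ilab)

lemmas iobjs = iobj_iform iobj_ilab iobj_ictx iobj_idual iobj_iunt iobj_ibtm iobj_iten iobj_ibang
lemmas fsts = fst_iform fst_ilab fst_ictx

lemma iiso_from_bidual:
  assumes "iobj X"
  shows "inv_arr M (fst X) (dual M (dual M (fst X))) (to_bidual M (fst X)) \<in> iiso (idual M (idual M X)) X"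
  using iiso_inv_arr[OF iiso_to_bidual[OF assms]] by simp

text \<open>The two maps call each other, so they are treated together, and for all \<open>j\<close>
  because exponentials and paragraphs lower it. The claim is \<open>iiso\<close> rather than
  \<open>ihom\<close> since the axiom rule inverts \<open>neg_iso\<close>.\<close>

lemma iiso_neg_iso_both:
  "neg_iso M v A \<in> iiso (idual M (iform M W (neg A) j)) (iform M W A j) \<and>
   neg_iso' M v A \<in> iiso (idual M (iform M W A j)) (iform M W (neg A) j)"
proof (induction A arbitrary: j)
  case (Var x)
  show ?case
    using iiso_from_bidual[OF iobj_W, of x j] iiso_Idn[OF iobj_idual[OF iobj_W], of x j] by simp
next
  case (NVar x)
  show ?case
    using iiso_from_bidual[OF iobj_W, of x j] iiso_Idn[OF iobj_idual[OF iobj_W], of x j] by simp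
next
  case One
  show ?case using iiso_inv_arr[OF iiso_Unt_dual_Btm] iiso_dual_Unt by simp
next
  case Bottom
  show ?case using iiso_inv_arr[OF iiso_Unt_dual_Btm] iiso_dual_Unt by simp
next
  case (Tensor A B)
  let ?X = "iten M (idual M (iform M W (neg A) j)) (idual M (iform M W (neg B) j))"
  have X: "iobj ?X" by (intro iobjs)
  have AB: "neg_iso M v A \<odot> neg_iso M v B \<in> iiso ?X (iten M (iform M W A j) (iform M W B j))"
    using Tensor by (intro iiso_TenA) auto
  show ?case
    using iiso_Cmp[OF iiso_from_bidual[OF X] AB] iiso_dual_arr[OF AB]
    by (simp add: fsts Let_def)
next
  case (Parr A B)
  let ?X = "iten M (idual M (iform M W A j)) (idual M (iform M W B j))"
  have X: "iobj ?X" by (intro iobjs)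
  have AB: "neg_iso' M v A \<odot> neg_iso' M v B \<in> iiso ?X (iten M (iform M W (neg A) j) (iform M W (neg B) j))"
    using Parr by (intro iiso_TenA) auto
  show ?case
    using iiso_Cmp[OF iiso_from_bidual[OF X] AB] iiso_dual_arr[OF AB]
    by (simp add: fsts Let_def)
next
  case (OfCourse A)
  let ?X = "ibang M (idual M (iform M W (neg A) (j - 1)))"
  have X: "iobj ?X" by (intro iobjs)
  have A: "bang_arr M (neg_iso M v A) \<in> iiso ?X (ibang M (iform M W A (j - 1)))"
    using OfCourse by (intro iiso_bang_arr) auto
  show ?case
    using iiso_Cmp[OF iiso_from_bidual[OF X] A] iiso_dual_arr[OF A]
    by (simp add: fsts Let_def)
next
  case (WhyNot A)
  let ?X = "ibang M (idual M (iform M W A (j - 1)))"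
  have X: "iobj ?X" by (intro iobjs)
  have A: "bang_arr M (neg_iso' M v A) \<in> iiso ?X (ibang M (iform M W (neg A) (j - 1)))"
    using WhyNot by (intro iiso_bang_arr) auto
  show ?case
    using iiso_Cmp[OF iiso_from_bidual[OF X] A] iiso_dual_arr[OF A]
    by (simp add: fsts Let_def)
next
  case (Para A)
  then show ?case by simp
qed

lemma iiso_neg_iso: "neg_iso M v A \<in> iiso (idual M (iform M W (neg A) j)) (iform M W A j)"
  using iiso_neg_iso_both by blast

lemma ihom_split_ctx:
  "split_ctx M v (map fst xs) (map fst ys)
    \<in> ihom (ictx M W (xs @ ys)) (iten M (ictx M W xs) (ictx M W ys))"
proof (induction xs)
  case Nil
  show ?case using iiso_ihom[OF iiso_inv_arr[OF iiso_Lun[OF iobj_ictx[of ys]]]] by (simp add: fsts)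
next
  case (Cons x xs)
  let ?X = "ilab M W (fst x) (snd x)"
  show ?case
    using ihom_Cmp[OF ihom_TenA[OF ihom_Idn[OF iobj_ilab[of "fst x" "snd x"]] Cons.IH]
        iiso_ihom[OF iiso_inv_arr[OF iiso_Asc[of ?X "ictx M W xs" "ictx M W ys"]]]]
    by (simp add: fsts iobjs)
qed

lemma ihom_swap_ctx:
  "swap_ctx M v (map fst xs) (fst a) (fst b) (map fst ys)
    \<in> ihom (ictx M W (xs @ b # a # ys)) (ictx M W (xs @ a # b # ys))"
proof (induction xs)
  case Nil
  let ?A = "ilab M W (fst a) (snd a)" and ?B = "ilab M W (fst b) (snd b)" and ?Y = "ictx M W ys"
  have o: "iobj ?A" "iobj ?B" "iobj ?Y" by (intro iobjs)+
  show ?case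
    using ihom_Cmp[OF iiso_ihom[OF iiso_inv_arr[OF iiso_Asc[OF o(2,1,3)]]]
        ihom_Cmp[OF ihom_TenA[OF ihom_Sym[OF o(2,1)] ihom_Idn[OF o(3)]] iiso_ihom[OF iiso_Asc[OF o]]]]
    by (simp add: fsts)
next
  case (Cons x xs)
  show ?case
    using ihom_TenA[OF ihom_Idn[OF iobj_ilab[of "fst x" "snd x"]] Cons.IH] by (simp add: fsts)
qed

text \<open>The diagonal duplicates one involution, so all copies share one \<open>j\<close>. This
  matches the common index of the premises of a why not link.\<close>

lemma ihom_contract_ctx:
  "contract_ctx M v A n (map fst ys)
    \<in> ihom (iten M (ibang M (iform M W (neg A) j)) (ictx M W ys))
        (ictx M W (replicate n (Flat A, j) @ ys))"
proof (induction n)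
  case 0
  show ?case
    using ihom_Cmp[OF ihom_TenA[OF ihom_weakening[OF iobj_iform[of "neg A" j]] ihom_Idn[OF iobj_ictx[of ys]]]
        iiso_ihom[OF iiso_Lun[OF iobj_ictx[of ys]]]]
    by (simp add: fsts)
next
  case (Suc n)
  let ?F = "iform M W (neg A) j" and ?Y = "ictx M W ys"
  have o: "iobj ?F" "iobj (ibang M ?F)" "iobj ?Y" by (intro iobjs)+
  show ?case
    using ihom_Cmp[OF ihom_TenA[OF ihom_contraction[OF o(1)] ihom_Idn[OF o(3)]]
        ihom_Cmp[OF iiso_ihom[OF iiso_Asc[OF o(2,2,3)]] ihom_TenA[OF ihom_Idn[OF o(2)] Suc.IH]]]
    by (simp add: fsts Let_def)
qed

lemma ihom_promote_ctx:
  "promote_ctx M v (map fst ps)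
    \<in> ihom (ictx M W (map (\<lambda>p. (Flat (fst p), snd p)) ps)) (ibang M (ictx M W (map (\<lambda>p. (Flat (fst p), snd p)) ps)))"
proof (induction ps)
  case Nil
  show ?case using ihom_bang_mon0 by simp
next
  case (Cons p ps)
  let ?F = "iform M W (neg (fst p)) (snd p)" and ?P = "ictx M W (map (\<lambda>p. (Flat (fst p), snd p)) ps)"
  show ?case
    using ihom_Cmp[OF ihom_TenA[OF ihom_digging[OF iobj_iform[of "neg (fst p)" "snd p"]] Cons.IH]
        ihom_bang_mon[of "ibang M ?F" ?P]]
    by (simp add: fsts iobjs comp_def)
qed

text \<open>The unit and \<open>Btm\<close> both carry identity involutions, with which every arrow
  commutes; hence any choice of mix arrows is equivariant.\<close>

lemma ihom_mix:
  "m \<in> Hom M \<one> (Btm M) \<Longrightarrow> m \<in> ihom (iunt M) (ibtm M)"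
  "m \<in> Hom M (Btm M) \<one> \<Longrightarrow> m \<in> ihom (ibtm M) (iunt M)"
  using Idn_left[OF Unt_obj Btm_obj, of m] Idn_right[OF Unt_obj Btm_obj, of m]
    Idn_left[OF Btm_obj Unt_obj, of m] Idn_right[OF Btm_obj Unt_obj, of m]
  by (simp_all add: ihom_def iobjs) (simp_all add: iunt_def ibtm_def)

text \<open>Every edge \<open>e\<close> carries the involution of its formula shifted by the index of \<open>e\<close>. The
  conditions on an exponential indexing say precisely that the links preserve these shifted
  involutions, once exponentials are read as \<open>!\<section>\<close> and \<open>?\<section>\<close>.\<close>

lemma ihom_seq_int:
  assumes "seq_int M v mix0 mix2 N \<Gamma> S f" and mix: "mix_arrows M mix0 mix2"
    and "\<forall>l\<in>S. index_ok I l"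
  shows "f \<in> ihom (ictx M W (map (\<lambda>e. (lab N e, k - I e)) \<Gamma>)) (ibtm M)"
  using assms(1,3)
proof induction
  case (ax a A b)
  let ?F = "iform M W A (k - I a)" and ?N = "iform M W (neg A) (k - I a)"
  have "inv_arr M (fst (idual M ?N)) (fst ?F) (neg_iso M v A) \<cdot> Run M (fst ?F)
      \<in> ihom (iten M ?F (iunt M)) (idual M ?N)"
    by (rule ihom_Cmp[OF iiso_ihom[OF iiso_Run] iiso_ihom[OF iiso_inv_arr[OF iiso_neg_iso]]])
       (intro iobjs)
  from ihom_Cmp[OF ihom_TenA[OF ihom_Idn[OF iobj_iform[of "neg A" "k - I a"]] this] ihom_Ev[OF iobj_iform]]
  show ?case using ax by (simp add: fsts)
next
  case (cut a A b \<Gamma> S f \<Delta> T g)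
  let ?F = "iform M W A (k - I a)" and ?N = "iform M W (neg A) (k - I a)"
  let ?x = "map (\<lambda>e. (lab N e, k - I e)) \<Gamma>" and ?y = "map (\<lambda>e. (lab N e, k - I e)) \<Delta>"
  \<comment> \<open>The two proofs have to meet at the same involution of \<open>A\<close>: the left
    one delivers \<open>?F\<close>, the right one consumes it.\<close>
  have I: "I b = I a" using cut.prems by simp
  have f: "f \<in> ihom (iten M ?N (ictx M W ?x)) (ibtm M)"
    and g: "g \<in> ihom (iten M ?F (ictx M W ?y)) (ibtm M)"
    using cut I by simp_all
  have "neg_iso M v A \<cdot> Cur M (fst ?N) (fst (ictx M W ?x)) (Btm M) f \<in> ihom (ictx M W ?x) ?F"
    by (rule ihom_Cmp[OF ihom_Cur[OF f] iiso_ihom[OF iiso_neg_iso]]) (intro iobjs)+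
  from ihom_Cmp[OF ihom_split_ctx[of ?x ?y] ihom_Cmp[OF ihom_TenA[OF this ihom_Idn[OF iobj_ictx]] g]]
  show ?case by (simp add: fsts comp_def)
next
  case (one c)
  then show ?case using iiso_ihom[OF iiso_Run[OF iobj_ibtm]] by simp
next
  case (bot c \<Gamma> S f)
  then have "f \<in> ihom (ictx M W (map (\<lambda>e. (lab N e, k - I e)) \<Gamma>)) (ibtm M)" by simp
  from ihom_Cmp[OF iiso_ihom[OF iiso_Lun[OF iobj_ictx]] this] show ?case
    using bot by (simp add: fsts comp_def)
next
  case (tensor a A b B c \<Gamma> S f \<Delta> T g)
  let ?A = "iform M W (neg A) (k - I c)" and ?B = "iform M W (neg B) (k - I c)"
  let ?x = "map (\<lambda>e. (lab N e, k - I e)) \<Gamma>" and ?y = "map (\<lambda>e. (lab N e, k - I e)) \<Delta>"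
  have I: "I a = I c" "I b = I c" using tensor.prems by simp_all
  have f: "f \<in> ihom (iten M ?A (ictx M W ?x)) (ibtm M)"
    and g: "g \<in> ihom (iten M ?B (ictx M W ?y)) (ibtm M)"
    using tensor I by simp_all
  from ihom_copair[OF ihom_Cmp[OF ihom_split_ctx[of ?x ?y]
      ihom_TenA[OF ihom_Cur[OF f iobj_iform iobj_ictx] ihom_Cur[OF g iobj_iform iobj_ictx]]]]
  show ?case using tensor by (simp add: fsts comp_def)
next
  case (par a A b B c \<Gamma> S f)
  let ?A = "iform M W (neg A) (k - I c)" and ?B = "iform M W (neg B) (k - I c)"
  let ?x = "map (\<lambda>e. (lab N e, k - I e)) \<Gamma>"
  have I: "I a = I c" "I b = I c" using par.prems by simp_all
  have f: "f \<in> ihom (iten M ?A (iten M ?B (ictx M W ?x))) (ibtm M)" using par I by simp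
  from ihom_Cmp[OF iiso_ihom[OF iiso_Asc[OF iobj_iform iobj_iform iobj_ictx]] f]
  show ?case using par by (simp add: fsts comp_def)
next
  case (flat a A c \<Gamma> S f)
  let ?A = "iform M W (neg A) (k - I c)"
  let ?x = "map (\<lambda>e. (lab N e, k - I e)) \<Gamma>"
  have I: "I a = I c" using flat.prems by simp
  have f: "f \<in> ihom (iten M ?A (ictx M W ?x)) (ibtm M)" using flat I by simp
  from ihom_Cmp[OF ihom_TenA[OF ihom_dereliction[OF iobj_iform] ihom_Idn[OF iobj_ictx]] f]
  show ?case using flat by (simp add: fsts comp_def)
next
  case (whynot as A c \<Gamma> S f)
  let ?x = "map (\<lambda>e. (lab N e, k - I e)) \<Gamma>"
  \<comment> \<open>The premises stand at \<open>I c + 1\<close>. They are read at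
    \<open>k - I c - 1\<close>, the index to which \<open>iform\<close> descends under the
    \<open>OfCourse\<close> that negates \<open>WhyNot A\<close>.\<close>
  have "\<forall>a\<in>set as. (lab N a, k - I a) = (Flat A, k - I c - 1)"
    using whynot.hyps(1) whynot.prems by simp
  then have "map (\<lambda>e. (lab N e, k - I e)) as = replicate (length as) (Flat A, k - I c - 1)"
    unfolding map_replicate_const[symmetric] by (intro map_cong) auto
  then have f: "f \<in> ihom (ictx M W (replicate (length as) (Flat A, k - I c - 1) @ ?x)) (ibtm M)"
    using whynot by simp
  from ihom_Cmp[OF ihom_contract_ctx f]
  show ?case using whynot by (simp add: fsts comp_def)
next
  case (ofcourse a A c ps As qs S f P)
  let ?A = "iform M W (neg A) (k - I c - 1)"
  \<comment> \<open>Unlike the principal formula, the auxiliary doors keep their index, so the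
    sequents inside and outside the box share the context \<open>?x\<close>. The indices recorded in
    \<open>js\<close> may differ from door to door.\<close>
  define js where "js = zip As (map (\<lambda>e. k - I e) ps)"
  let ?x = "map (\<lambda>p. (Flat (fst p), snd p)) js"
  have len: "length ps = length As" "length qs = length As"
    using ofcourse.hyps(3,4) by (metis length_map)+
  have I: "k - I a = k - I c - 1" using ofcourse.prems by simp
  have Ipq: "I (ps ! i) = I (qs ! i)" if "i < length As" for i
  proof -
    have "LPax (ps ! i) (qs ! i) \<in> P"
      using that len by (auto simp: ofcourse.hyps(7) set_zip)
    then have "index_ok I (LPax (ps ! i) (qs ! i))" using ofcourse.prems by blast
    then show ?thesis by simp
  qed
  have lab: "lab N (ps ! i) = Flat (As ! i)" "lab N (qs ! i) = Flat (As ! i)" if "i < length As" for i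
    using ofcourse.hyps(3,4) that len by (metis nth_map)+
  have x: "map (\<lambda>e. (lab N e, k - I e)) ps = ?x" "map (\<lambda>e. (lab N e, k - I e)) qs = ?x"
    by (rule nth_equalityI; simp add: js_def len lab Ipq)+
  have fst_js: "map fst js = As" using len by (simp add: js_def)
  then have flat_js: "map (\<lambda>p. Flat (fst p)) js = map Flat As" by auto
  have f: "f \<in> ihom (iten M ?A (ictx M W ?x)) (ibtm M)" using ofcourse x I by simp
  from ihom_copair[OF ihom_Cmp[OF ihom_promote_ctx[of js]
      ihom_bang_arr[OF ihom_Cur[OF f iobj_iform iobj_ictx]]]]
  show ?case by (simp add: x ofcourse.hyps(2) fst_js flat_js fsts comp_def)
next
  case (para a A c \<Gamma> S f)
  \<comment> \<open>The rule keeps \<open>f\<close>, as the paragraph functor fixes arrows. The step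
    of the indexing across the link compensates the shift in \<open>iform\<close> of
    \<open>Para\<close>, so premise and conclusion have the same context object.\<close>
  have I: "k - I a = k - I c - 1" using para.prems by simp
  have "f \<in> ihom (ictx M W (map (\<lambda>e. (lab N e, k - I e)) (a # \<Gamma>))) (ibtm M)"
    using para by simp
  then show ?case using para.hyps by (simp add: I)
next
  case (exchange \<Gamma> a b \<Delta> S f)
  let ?l = "\<lambda>e. (lab N e, k - I e)"
  have f: "f \<in> ihom (ictx M W (map ?l \<Gamma> @ ?l a # ?l b # map ?l \<Delta>)) (ibtm M)" using exchange by simp
  from ihom_Cmp[OF ihom_swap_ctx f] show ?case by (simp add: comp_def)
next
  case (mix_empty m)
  then show ?case using mix ihom_mix(1)[of m] by (simp add: mix_arrows_def)
next
  case (mix_binary m \<Gamma> S f \<Delta> T g)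
  let ?x = "map (\<lambda>e. (lab N e, k - I e)) \<Gamma>" and ?y = "map (\<lambda>e. (lab N e, k - I e)) \<Delta>"
  have m: "m \<in> ihom (ibtm M) (iunt M)" using mix mix_binary ihom_mix(2)[of m] by (simp add: mix_arrows_def)
  have f: "f \<in> ihom (ictx M W ?x) (ibtm M)" and g: "g \<in> ihom (ictx M W ?y) (ibtm M)"
    using mix_binary by simp_all
  from ihom_Cmp[OF ihom_split_ctx[of ?x ?y] ihom_Cmp[OF ihom_TenA[OF ihom_Cmp[OF f m] g]
      iiso_ihom[OF iiso_Lun[OF iobj_ibtm]]]]
  show ?case by (simp add: comp_def)
qed

section \<open>From single indices to morphisms of \<open>Inv M\<close>\<close>

lemma ihom_net_int:
  assumes "net_int M v mix0 mix2 N g" "mix_arrows M mix0 mix2" "of_conclusion N A"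
    and "\<forall>l\<in>links N. index_ok I l"
  shows "g \<in> ihom (iunt M) (iform M W A j)"
proof -
  obtain e f where e: "lab N e = Plain A" "seq_int M v mix0 mix2 N [e] (links N) f"
    and g: "g = neg_iso M v A \<cdot> Cur M (fobj M v (neg A)) \<one> (Btm M) f"
    using assms(1,3) unfolding net_int_def of_conclusion_def by fastforce
  have f: "f \<in> ihom (iten M (iform M W (neg A) j) (iunt M)) (ibtm M)"
    using ihom_seq_int[OF e(2) assms(2,4), of "j + I e"] e(1) by simp
  from ihom_Cmp[OF ihom_Cur[OF f iobj_iform iobj_iunt] iiso_ihom[OF iiso_neg_iso]]
  show ?thesis using g by (simp add: fsts)
qed

lemma Inv_hom_net_int:
  assumes "net_int M v mix0 mix2 N g" "mix_arrows M mix0 mix2" "of_conclusion N A"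
    and "\<forall>l\<in>links N. index_ok I l"
  shows "g \<in> Hom (Inv M) (\<one>, \<lambda>k. Idn M \<one>) (fint (inv_alg M) W (plus_form A))"
proof -
  obtain B t where Bt: "fint (inv_alg M) W (plus_form A) = (B, t)" by (cases "fint (inv_alg M) W (plus_form A)")
  \<comment> \<open>The arrow \<open>g\<close> does not depend on \<open>j\<close>: one arrow is
    equivariant at all indices, as a morphism of \<open>Inv M\<close> has to be.\<close>
  have g: "g \<in> ihom (iunt M) (B, t j)" for j
    using ihom_net_int[OF assms, of j] by (simp add: iform_def Bt)
  have B: "B \<in> Obj M" and gh: "g \<in> Hom M \<one> B" and tg: "t j \<cdot> g = g \<cdot> Idn M \<one>" for j
    using ihomD(4,5,8)[OF g, of j] by (simp_all add: iunt_def)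
  have "(B, t) \<in> Inv_obj M" "(\<one>, \<lambda>k. Idn M \<one>) \<in> Inv_obj M"
    using ihomD(1,2)[OF g] by (simp_all add: Inv_obj_def iobj_def iunt_def)
  moreover have "t j \<cdot> g \<cdot> Idn M \<one> = g" for j
    using tg[of j] Idn_right[OF Unt_obj B gh] by simp
  ultimately show ?thesis using gh by (simp add: Inv_def Bt)
qed

end

text \<open>At index 0 the involution law is \<open>Sym_Sym\<close> with both objects equal to
  \<open>\<Xi>\<close>; elsewhere it is an identity law.\<close>

lemma (in ll_model) default_assignment_Inv_obj:
  assumes "\<Xi> \<in> Obj M"
  shows "default_assignment M \<Xi> x \<in> Inv_obj M"
  using assms Idn_left[OF _ _ Idn_hom[OF Ten_obj[OF assms assms]]]
  by (simp add: default_assignment_def Inv_obj_def Ten_obj Sym_hom Sym_Sym Idn_hom)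

theorem mainTheorem13:
  fixes M :: "('o, 'a, 'p, 'b) llm" and \<Xi> :: 'o
    and mix0 mix2 :: "'a option"
    and \<pi> :: "'e net" and A :: form and f :: 'a
  assumes "ll_model M" and "nontrivial M"
    and "\<Xi> \<in> Obj M" and "Sym M \<Xi> \<Xi> \<noteq> Idn M (Ten M \<Xi> \<Xi>)"
    and "mix_arrows M mix0 mix2"
    and "DR_net \<pi>" and "of_conclusion \<pi> A"
    and "net_int M (\<lambda>x. fst (default_assignment M \<Xi> x)) mix0 mix2 \<pi> f"
    and "\<pi> \<in> L3"
  shows "f \<in> Hom (Inv M) (Unt M, \<lambda>k. Idn M (Unt M)) (default_fint M \<Xi> (plus_form A))"
proof -
  interpret ll_model M by fact
  interpret inv_valuation M "default_assignment M \<Xi>"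
    by unfold_locales (rule default_assignment_Inv_obj[OF assms(3)])
  obtain I where "\<forall>l\<in>links \<pi>. index_ok I l"
    using assms(9) by (auto simp: L3_def exponential_indexing_def)
  from Inv_hom_net_int[OF assms(8,5,7) this] show ?thesis by (simp add: default_fint_def)
qed

end
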